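(* Let $\mathcal L_n$ be the length of a longest simple path in the uniformly random Apollonian network obtained after $n$ insertion steps. Then there exists a constant $c>0$ such that $$\lim_{n\to\infty}\mathbf{P}\{\mathcal L_n\ge c n\}=1 .$$
   Context: An Apollonian network is built recursively: start with three vertices forming a triangle in the plane; in each step choose one of the current (bounded) triangular faces, place a new vertex inside it, and connect it to the three vertices of this triangle, replacing that face by three new ones. After $n$ steps the graph has $n+3$ vertices. The construction is encoded by an ordered rooted ternary tree: the root represents the original triangle, and inserting a vertex into a triangle (a leaf of the tree) gives that leaf three ordered children representing the three new triangles; after $n$ steps the tree has $3n+1$ nodes, of which $2n+1$ are leaves, and every non-leaf node has exactly three children. This gives a one-to-one correspondence between ordered rooted trees with $3n+1$ nodes in which every non-leaf node has exactly three children and Apollonian networks with $n$ steps. The uniformly random Apollonian network after $n$ steps is the network corresponding to such a tree chosen uniformly at random (equivalently, a Galton-Watson tree with $p_0=2/3$, $p_3=1/3$ conditioned to have size $3n+1$). A simple path is a path visiting every vertex at most once; its length is its number of edges. *)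

theory Defs
  imports
    "HOL-Probability.Probability_Mass_Function"
    "Graph_Theory.Pair_Digraph"
    "Graph_Theory.Vertex_Walk"
begin

section \<open>Ordered rooted trees in which every non-leaf node has three children\<close>

datatype ternary_tree = Leaf | Node ternary_tree ternary_tree ternary_tree

fun num_nodes :: "ternary_tree \<Rightarrow> nat" where
  "num_nodes Leaf = 1"
| "num_nodes (Node t1 t2 t3) = 1 + num_nodes t1 + num_nodes t2 + num_nodes t3"

definition step_trees :: "nat \<Rightarrow> ternary_tree set" where
  "step_trees n = {t. num_nodes t = 3 * n + 1}"

section \<open>The Apollonian network encoded by a tree\<close>

text \<open>
  A node of the tree is addressed by the list of child indices on the way from the root to it.
  A non-leaf node with address \<open>p\<close> represents a triangle that has been subdivided, and the vertex
  placed inside that triangle is \<open>Inserted p\<close>.  Only the three corners of the original triangle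
  are not of this form.
\<close>

datatype vertex = Corner nat | Inserted "nat list"

fun inserted_vertices :: "nat list \<Rightarrow> ternary_tree \<Rightarrow> vertex set" where
  "inserted_vertices p Leaf = {}"
| "inserted_vertices p (Node t1 t2 t3) =
     insert (Inserted p)
       (inserted_vertices (p @ [1]) t1 \<union> inserted_vertices (p @ [2]) t2
        \<union> inserted_vertices (p @ [3]) t3)"

text \<open>
  \<open>inserted_edges p x y z t\<close> are the edges created inside the triangle \<open>x y z\<close> by the subtree \<open>t\<close>
  rooted at address \<open>p\<close>.  Each edge is listed once, in one of its two orientations.  The three new
  triangles arise by replacing one of the corners of the old triangle by the new vertex.
\<close>

fun inserted_edges ::
  "nat list \<Rightarrow> vertex \<Rightarrow> vertex \<Rightarrow> vertex \<Rightarrow> ternary_tree \<Rightarrow> (vertex \<times> vertex) set" where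
  "inserted_edges p x y z Leaf = {}"
| "inserted_edges p x y z (Node t1 t2 t3) =
     (let v = Inserted p in
        {(v, x), (v, y), (v, z)}
        \<union> inserted_edges (p @ [1]) v y z t1
        \<union> inserted_edges (p @ [2]) x v z t2
        \<union> inserted_edges (p @ [3]) x y v t3)"

definition network_edges :: "ternary_tree \<Rightarrow> (vertex \<times> vertex) set" where
  "network_edges t =
     {(Corner 1, Corner 2), (Corner 2, Corner 3), (Corner 3, Corner 1)}
     \<union> inserted_edges [] (Corner 1) (Corner 2) (Corner 3) t"

text \<open>An undirected graph is a symmetric digraph: each edge is present in both orientations.\<close>

definition apollonian_network :: "ternary_tree \<Rightarrow> vertex pair_pre_digraph" where
  "apollonian_network t =
     \<lparr> pverts = {Corner 1, Corner 2, Corner 3} \<union> inserted_vertices [] t,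
       parcs = network_edges t \<union> (network_edges t)\<inverse> \<rparr>"

definition random_apollonian_network :: "nat \<Rightarrow> vertex pair_pre_digraph pmf" where
  "random_apollonian_network n = map_pmf apollonian_network (pmf_of_set (step_trees n))"

definition longest_path_length :: "'v pair_pre_digraph \<Rightarrow> nat" where
  "longest_path_length G = Max {vwalk_length p | p. vpath p (with_proj G)}"

section \<open>Well-definedness\<close>

text \<open>The set of trees is finite and nonempty, so \<open>pmf_of_set\<close> is the uniform distribution on it.\<close>

lemma num_nodes_pos: "num_nodes t > 0"
  by (cases t) auto

lemma finite_num_nodes_le: "finite {t. num_nodes t \<le> n}"
proof (induction n)
  case 0
  have "{t. num_nodes t \<le> 0} = {}"
    using num_nodes_pos by (auto simp: not_le)
  then show ?case by (simp only: finite.emptyI)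
next
  case (Suc n)
  let ?A = "{t. num_nodes t \<le> n}"
  have "{t. num_nodes t \<le> Suc n}
      \<subseteq> insert Leaf ((\<lambda>(t1, t2, t3). Node t1 t2 t3) ` (?A \<times> ?A \<times> ?A))"
  proof
    fix t assume "t \<in> {t. num_nodes t \<le> Suc n}"
    then show "t \<in> insert Leaf ((\<lambda>(t1, t2, t3). Node t1 t2 t3) ` (?A \<times> ?A \<times> ?A))"
      by (cases t) (auto simp: image_iff)
  qed
  then show ?case
    by (rule finite_subset) (intro finite.insertI finite_imageI finite_cartesian_product Suc)
qed

lemma finite_step_trees: "finite (step_trees n)"
  by (rule finite_subset[OF _ finite_num_nodes_le[of "3 * n + 1"]]) (auto simp: step_trees_def)

lemma step_trees_nonempty: "step_trees n \<noteq> {}"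
proof -
  have "\<exists>t. num_nodes t = 3 * n + 1"
  proof (induction n)
    case 0
    have "num_nodes Leaf = 3 * 0 + 1" by simp
    then show ?case by blast
  next
    case (Suc n)
    then obtain t where "num_nodes t = 3 * n + 1" by blast
    then have "num_nodes (Node t Leaf Leaf) = 3 * Suc n + 1" by simp
    then show ?case by blast
  qed
  then show ?thesis by (auto simp: step_trees_def)
qed

lemma inserted_vertices_prefix:
  "v \<in> inserted_vertices p t \<Longrightarrow> \<exists>q. v = Inserted (p @ q)"
  by (induction p t rule: inserted_vertices.induct) fastforce+

lemma finite_inserted_vertices: "finite (inserted_vertices p t)"
  by (induction p t rule: inserted_vertices.induct) auto

lemma card_inserted_vertices: "num_nodes t = 3 * card (inserted_vertices p t) + 1"
proof (induction p t rule: inserted_vertices.induct)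
  case (2 p t1 t2 t3)
  let ?V1 = "inserted_vertices (p @ [1]) t1" and ?V2 = "inserted_vertices (p @ [2]) t2"
    and ?V3 = "inserted_vertices (p @ [3]) t3"
  have "?V1 \<inter> ?V2 = {}" "(?V1 \<union> ?V2) \<inter> ?V3 = {}" "Inserted p \<notin> ?V1 \<union> ?V2 \<union> ?V3"
    by (fastforce dest!: inserted_vertices_prefix)+
  then have "card (inserted_vertices p (Node t1 t2 t3)) = Suc (card ?V1 + card ?V2 + card ?V3)"
    by (simp add: finite_inserted_vertices card_Un_disjoint)
  with 2 show ?case by simp
qed simp

lemma card_verts_apollonian_network:
  assumes "t \<in> step_trees n"
  shows "card (pverts (apollonian_network t)) = n + 3"
proof -
  have "{Corner 1, Corner 2, Corner 3} \<inter> inserted_vertices [] t = {}"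
    by (auto dest: inserted_vertices_prefix)
  moreover have "card (inserted_vertices [] t) = n"
    using assms card_inserted_vertices[of t "[]"] by (simp add: step_trees_def)
  ultimately show ?thesis
    by (simp add: apollonian_network_def card_Un_disjoint finite_inserted_vertices
        del: Un_insert_left)
qed

lemma finite_inserted_edges: "finite (inserted_edges p x y z t)"
  by (induction p x y z t rule: inserted_edges.induct) (auto simp: Let_def)

lemma inserted_edges_subset:
  assumes "(u, v) \<in> inserted_edges p x y z t"
    and "\<forall>q. Inserted (p @ q) \<notin> {x, y, z}"
  shows "u \<in> inserted_vertices p t \<and> v \<in> {x, y, z} \<union> inserted_vertices p t \<and> u \<noteq> v"
  using assms
proof (induction p x y z t rule: inserted_edges.induct)
  case (2 p x y z t1 t2 t3)
  have new: "\<forall>q. Inserted (p @ q) \<noteq> w" if "w \<in> {x, y, z}" for w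
    using that 2(5) by auto
  then have "Inserted p \<notin> {x, y, z}"
    by (metis append_Nil2)
  moreover have "\<forall>q. Inserted ((p @ [i]) @ q) \<notin> {Inserted p, x, y, z}" for i
    using new by auto
  ultimately show ?case
    using 2(1)[OF refl] 2(2)[OF refl] 2(3)[OF refl] 2(4) by (auto simp: Let_def)
qed simp

lemma pair_graph_apollonian_network: "pair_graph (apollonian_network t)"
proof -
  have *: "u \<in> pverts (apollonian_network t) \<and> v \<in> pverts (apollonian_network t) \<and> u \<noteq> v"
    if "(u, v) \<in> parcs (apollonian_network t)" for u v
    using that inserted_edges_subset[of u v "[]" "Corner 1" "Corner 2" "Corner 3" t]
      inserted_edges_subset[of v u "[]" "Corner 1" "Corner 2" "Corner 3" t]
    by (auto simp: apollonian_network_def network_edges_def)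
  have "symmetric (with_proj (apollonian_network t))"
    by (auto simp: symmetric_def apollonian_network_def sym_Un_converse)
  moreover have "finite (pverts (apollonian_network t))" "finite (parcs (apollonian_network t))"
    by (auto simp: apollonian_network_def network_edges_def finite_inserted_vertices
        finite_inserted_edges)
  ultimately show ?thesis
    using * by unfold_locales auto
qed

text \<open>The maximum in \<open>longest_path_length\<close> is over a finite nonempty set.\<close>

lemma finite_path_lengths:
  assumes "finite (pverts G)"
  shows "finite {vwalk_length p | p. vpath p (with_proj G)}"
proof -
  have "{p. vpath p (with_proj G)} \<subseteq> {p. set p \<subseteq> pverts G \<and> length p \<le> card (pverts G)}"
    by (auto simp: vpath_def vwalk_def) (metis assms card_mono distinct_card)
  then have "finite {p. vpath p (with_proj G)}"
    by (rule finite_subset) (rule finite_lists_length_le[OF assms])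
  then show ?thesis
    by (simp add: Setcompr_eq_image)
qed

lemma path_lengths_nonempty:
  "{vwalk_length p | p. vpath p (with_proj (apollonian_network t))} \<noteq> {}"
proof -
  have "vpath [Corner 1] (with_proj (apollonian_network t))"
    by (auto simp: vpath_def vwalk_def apollonian_network_def)
  then show ?thesis by blast
qed

end

(*
  A path through a subdivided triangle can use two of the three new triangles, so the longest path
  is at least the number B(t) of leaves of a largest binary subtree of the ternary tree t.

  Keeping the two larger of three subtrees costs the smallest one.  The cost is charged to what is
  kept unless two of the subtrees have more than K leaves.  Numbers of trees grow like
  (27/4)^n n^(-3/2), and so the mean total of these exceptional costs is only O(K^(-1/5)) n.
  With K fixed, this already shows that B has linear mean.

  For a bound with high probability the constant must not depend on K.  Up to a factor 3 and the
  exceptional costs, B(t) is at least the sum of B over the maximal subtrees with at most K leaves.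
  This sum is additive above the threshold, so its exponential moments factor along the tree, and
  the linear mean gives an exponentially small probability that it is small.  The exceptional costs
  are handled by Markov's inequality, letting K tend to infinity.
*)

theory Submission
  imports Defs "HOL-Computational_Algebra.Formal_Power_Series"
begin

section \<open>Paths and binary subtrees\<close>

fun insertions :: "ternary_tree \<Rightarrow> nat" where
  "insertions Leaf = 0"
| "insertions (Node a b c) = Suc (insertions a + insertions b + insertions c)"

fun leaves :: "ternary_tree \<Rightarrow> nat" where
  "leaves Leaf = 1"
| "leaves (Node a b c) = leaves a + leaves b + leaves c"

fun binary_leaves :: "ternary_tree \<Rightarrow> nat" where
  "binary_leaves Leaf = 1"
| "binary_leaves (Node a b c) =
     max (binary_leaves a + binary_leaves b)
       (max (binary_leaves a + binary_leaves c) (binary_leaves b + binary_leaves c))"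

lemma num_nodes_eq_insertions: "num_nodes t = 3 * insertions t + 1"
  by (induction t) auto

lemma leaves_eq_insertions: "leaves t = 2 * insertions t + 1"
  by (induction t) auto

lemma step_trees_eq: "step_trees n = {t. insertions t = n}"
  by (auto simp: step_trees_def num_nodes_eq_insertions)

lemma binary_leaves_pos: "binary_leaves t > 0"
  by (induction t) auto

lemma binary_leaves_le: "binary_leaves t \<le> leaves t"
  by (induction t) auto

lemma vwalk_arcs_join:
  "set (vwalk_arcs (xs @ v # ys)) = set (vwalk_arcs (xs @ [v])) \<union> set (vwalk_arcs (v # ys))"
  by (induction xs rule: vwalk_arcs.induct) auto

text \<open>Only the inner vertices are confined to \<open>V\<close>; the endpoints are passed
  separately. Neighbouring triangles share corners but have disjoint sets of inserted vertices, so
  paths through them can be joined at a shared corner. The number \<open>n\<close> counts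
  edges.\<close>

definition interior_path ::
  "(vertex \<times> vertex) set \<Rightarrow> vertex set \<Rightarrow> vertex \<Rightarrow> vertex \<Rightarrow> nat \<Rightarrow> bool" where
  "interior_path R V a b n \<longleftrightarrow>
     (\<exists>l. set l \<subseteq> V \<and> distinct l \<and> length l + 1 = n \<and> set (vwalk_arcs (a # l @ [b])) \<subseteq> R)"

lemma interior_path_join:
  assumes "interior_path R V a v m" "interior_path R W v b n"
    and "V \<inter> W = {}" "v \<notin> V \<union> W" "insert v (V \<union> W) \<subseteq> U"
  shows "interior_path R U a b (m + n)"
proof -
  obtain k l where k: "set k \<subseteq> V" "distinct k" "length k + 1 = m" "set (vwalk_arcs (a # k @ [v])) \<subseteq> R"
    and l: "set l \<subseteq> W" "distinct l" "length l + 1 = n" "set (vwalk_arcs (v # l @ [b])) \<subseteq> R"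
    using assms(1,2) unfolding interior_path_def by blast
  have "set (vwalk_arcs (a # (k @ v # l) @ [b])) \<subseteq> R"
    using k(4) l(4) vwalk_arcs_join[of "a # k" v "l @ [b]"] by simp
  moreover have "distinct (k @ v # l)" "set (k @ v # l) \<subseteq> U"
    using k l assms(3-5) by auto
  ultimately show ?thesis
    unfolding interior_path_def using k(3) l(3) by (intro exI[of _ "k @ v # l"]) auto
qed

text \<open>
  A path from \<open>a\<close> to \<open>b\<close> inside a subdivided triangle passes through the new vertex and uses any two
  of the three new triangles, so the smallest of the three subtrees can be given up.
\<close>

lemma interior_path_binary_leaves:
  assumes "inserted_edges p x y z t \<subseteq> R" "sym R" "{(x, y), (y, z), (x, z)} \<subseteq> R"
    and "\<forall>q. Inserted (p @ q) \<notin> {x, y, z}" "{a, b} \<subseteq> {x, y, z}" "a \<noteq> b"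
  shows "interior_path R (inserted_vertices p t) a b (binary_leaves t)"
  using assms
proof (induction p x y z t arbitrary: a b rule: inserted_edges.induct)
  case (1 p x y z)
  then have "(a, b) \<in> R" by (auto dest: symD)
  then show ?case
    unfolding interior_path_def by (intro exI[of _ "[]"]) auto
next
  case (2 p x y z t1 t2 t3)
  let ?v = "Inserted p"
  let ?V1 = "inserted_vertices (p @ [1]) t1" and ?V2 = "inserted_vertices (p @ [2]) t2"
    and ?V3 = "inserted_vertices (p @ [3]) t3" and ?V = "inserted_vertices p (Node t1 t2 t3)"
  have disj: "?V1 \<inter> ?V2 = {}" "?V1 \<inter> ?V3 = {}" "?V2 \<inter> ?V3 = {}"
    "?v \<notin> ?V1" "?v \<notin> ?V2" "?v \<notin> ?V3"
    by (fastforce dest!: inserted_vertices_prefix)+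
  have R: "inserted_edges (p @ [1]) ?v y z t1 \<subseteq> R" "inserted_edges (p @ [2]) x ?v z t2 \<subseteq> R"
    "inserted_edges (p @ [3]) x y ?v t3 \<subseteq> R" "(?v, x) \<in> R" "(?v, y) \<in> R" "(?v, z) \<in> R"
    using 2(4) by (auto simp: Let_def)
  have R': "(x, ?v) \<in> R" "(y, ?v) \<in> R" "(z, ?v) \<in> R"
    using R 2(5) by (auto dest: symD)
  have new: "\<forall>q. Inserted (p @ q) \<noteq> w" if "w \<in> {x, y, z}" for w
    using that 2(7) by auto
  then have ne: "?v \<noteq> x" "?v \<noteq> y" "?v \<noteq> z"
    by (metis append_Nil2 insertI1 insertI2)+
  have new': "\<forall>q. Inserted ((p @ [i]) @ q) \<notin> {Inserted p, x, y, z}" for i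
    using new by auto
  \<comment> \<open>The first new triangle has corners \<open>?v\<close>, \<open>y\<close>,
    \<open>z\<close>. Both directions are recorded, since it may be traversed either before or after
    \<open>?v\<close>. The other two triangles are treated alike.\<close>
  have P1: "interior_path R ?V1 u ?v (binary_leaves t1) \<and> interior_path R ?V1 ?v u (binary_leaves t1)"
    if "u \<in> {y, z}" for u
  proof -
    have "?v \<noteq> u" using that ne by auto
    then show ?thesis
      using 2(1)[OF refl R(1) 2(5), of u ?v] 2(1)[OF refl R(1) 2(5), of ?v u]
        that R R' 2(6) new'[of 1] by blast
  qed
  have P2: "interior_path R ?V2 u ?v (binary_leaves t2) \<and> interior_path R ?V2 ?v u (binary_leaves t2)"
    if "u \<in> {x, z}" for u
  proof -
    have "?v \<noteq> u" using that ne by auto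
    then show ?thesis
      using 2(2)[OF refl R(2) 2(5), of u ?v] 2(2)[OF refl R(2) 2(5), of ?v u]
        that R R' 2(6) new'[of 2] by blast
  qed
  have P3: "interior_path R ?V3 u ?v (binary_leaves t3) \<and> interior_path R ?V3 ?v u (binary_leaves t3)"
    if "u \<in> {x, y}" for u
  proof -
    have "?v \<noteq> u" using that ne by auto
    then show ?thesis
      using 2(3)[OF refl R(3) 2(5), of u ?v] 2(3)[OF refl R(3) 2(5), of ?v u]
        that R R' 2(6) new'[of 3] by blast
  qed
  have J: "interior_path R ?V a b (m + n)"
    if "interior_path R W a ?v m \<and> interior_path R W' ?v b n \<or>
        interior_path R W' a ?v n \<and> interior_path R W ?v b m"
      "W \<inter> W' = {}" "?v \<notin> W" "?v \<notin> W'" "W \<union> W' \<subseteq> ?V" for W W' m n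
    using that interior_path_join[of R W a ?v m W' b n ?V]
      interior_path_join[of R W' a ?v n W b m ?V] by (auto simp: add.commute)
  have "interior_path R ?V a b (binary_leaves t1 + binary_leaves t2)"
  proof (rule J)
    show "interior_path R ?V1 a ?v (binary_leaves t1) \<and> interior_path R ?V2 ?v b (binary_leaves t2) \<or>
        interior_path R ?V2 a ?v (binary_leaves t2) \<and> interior_path R ?V1 ?v b (binary_leaves t1)"
    proof -
      \<comment> \<open>The first triangle lacks only the corner \<open>x\<close> and the second
        only \<open>y\<close>. As \<open>a\<close> and \<open>b\<close> differ, one can be assigned
        to each triangle.\<close>
      have "a \<in> {y, z} \<and> b \<in> {x, z} \<or> a \<in> {x, z} \<and> b \<in> {y, z}"
        using 2(8,9) by auto
      then show ?thesis using P1 P2 by blast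
    qed
  qed (use disj in auto)
  moreover have "interior_path R ?V a b (binary_leaves t1 + binary_leaves t3)"
  proof (rule J)
    show "interior_path R ?V1 a ?v (binary_leaves t1) \<and> interior_path R ?V3 ?v b (binary_leaves t3) \<or>
        interior_path R ?V3 a ?v (binary_leaves t3) \<and> interior_path R ?V1 ?v b (binary_leaves t1)"
    proof -
      have "a \<in> {y, z} \<and> b \<in> {x, y} \<or> a \<in> {x, y} \<and> b \<in> {y, z}"
        using 2(8,9) by auto
      then show ?thesis using P1 P3 by blast
    qed
  qed (use disj in auto)
  moreover have "interior_path R ?V a b (binary_leaves t2 + binary_leaves t3)"
  proof (rule J)
    show "interior_path R ?V2 a ?v (binary_leaves t2) \<and> interior_path R ?V3 ?v b (binary_leaves t3) \<or>
        interior_path R ?V3 a ?v (binary_leaves t3) \<and> interior_path R ?V2 ?v b (binary_leaves t2)"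
    proof -
      have "a \<in> {x, z} \<and> b \<in> {x, y} \<or> a \<in> {x, y} \<and> b \<in> {x, z}"
        using 2(8,9) by auto
      then show ?thesis using P2 P3 by blast
    qed
  qed (use disj in auto)
  ultimately show ?case
    by (simp only: binary_leaves.simps max_def split: if_splits) auto
qed

text \<open>The corners of the original triangle are never inserted vertices, so an interior path
  between two of them becomes a simple path of the whole network when its endpoints are
  added.\<close>

lemma longest_path_length_ge: "binary_leaves t \<le> longest_path_length (apollonian_network t)"
proof -
  let ?G = "apollonian_network t" and ?V = "inserted_vertices [] t"
  have "interior_path (parcs ?G) ?V (Corner 1) (Corner 2) (binary_leaves t)"
  proof (rule interior_path_binary_leaves)
    show "sym (parcs ?G)" by (simp add: apollonian_network_def sym_Un_converse)
  qed (auto simp: apollonian_network_def network_edges_def)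
  then obtain l where l: "set l \<subseteq> ?V" "distinct l" "length l + 1 = binary_leaves t"
    "set (vwalk_arcs (Corner 1 # l @ [Corner 2])) \<subseteq> parcs ?G"
    unfolding interior_path_def by blast
  have "Corner i \<notin> ?V" for i by (auto dest: inserted_vertices_prefix)
  then have "vpath (Corner 1 # l @ [Corner 2]) (with_proj ?G)"
    using l unfolding vpath_def vwalk_def by (auto simp: apollonian_network_def)
  then have "vwalk_length (Corner 1 # l @ [Corner 2]) \<le> longest_path_length ?G"
    unfolding longest_path_length_def
    by (intro Max_ge finite_path_lengths CollectI exI conjI)
      (auto simp only: apollonian_network_def pair_pre_digraph.simps finite_inserted_vertices
        finite_Un finite_insert finite.emptyI)
  then show ?thesis using l(3) by simp
qed

section \<open>Generating functions of ternary trees\<close>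

definition tree_gf :: "(ternary_tree \<Rightarrow> real) \<Rightarrow> real fps" where
  "tree_gf w = Abs_fps (\<lambda>n. \<Sum>t\<in>step_trees n. w t)"

text \<open>The value 0 at \<open>Leaf\<close> leaves the empty tree to a separate summand, so that
  this part alone corresponds to a product of three generating functions.\<close>

fun node_weight ::
  "(ternary_tree \<Rightarrow> ternary_tree \<Rightarrow> ternary_tree \<Rightarrow> real) \<Rightarrow> ternary_tree \<Rightarrow> real" where
  "node_weight f Leaf = 0"
| "node_weight f (Node a b c) = f a b c"

lemma tree_gf_nth: "fps_nth (tree_gf w) n = (\<Sum>t\<in>step_trees n. w t)"
  by (simp add: tree_gf_def)

lemma step_trees_0: "step_trees 0 = {Leaf}"
proof -
  have "insertions t = 0 \<longleftrightarrow> t = Leaf" for t by (cases t) auto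
  then show ?thesis by (auto simp: step_trees_eq)
qed

lemma sum_step_trees_Suc:
  fixes f g h :: "ternary_tree \<Rightarrow> real"
  shows "(\<Sum>t\<in>step_trees (Suc n). node_weight (\<lambda>a b c. f a * g b * h c) t) =
    fps_nth (tree_gf f * tree_gf g * tree_gf h) n"
proof -
  \<comment> \<open>The indices follow the nested Cauchy product: \<open>j\<close> is the size of
    the first subtree and \<open>i\<close> that of the first two together.\<close>
  let ?S = "SIGMA i:{0..n}. SIGMA j:{0..i}. step_trees j \<times> step_trees (i - j) \<times> step_trees (n - i)"
  have "fps_nth (tree_gf f * tree_gf g * tree_gf h) n =
    (\<Sum>i=0..n. \<Sum>j=0..i. \<Sum>a\<in>step_trees j. \<Sum>b\<in>step_trees (i - j). \<Sum>c\<in>step_trees (n - i).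
      f a * g b * h c)"
    unfolding fps_mult_nth tree_gf_nth sum_distrib_right sum_product
    by (intro sum.cong refl) (simp only: sum_product sum_distrib_right sum_distrib_left, rule sum.swap)
  also have "\<dots> = (\<Sum>(i, j, a, b, c)\<in>?S. f a * g b * h c)"
    by (simp add: sum.Sigma finite_step_trees split_def)
  also have "\<dots> = (\<Sum>t\<in>step_trees (Suc n). node_weight (\<lambda>a b c. f a * g b * h c) t)"
  proof (rule sum.reindex_bij_witness)
    let ?j = "\<lambda>(i, j, a, b, c). Node a b c"
    let ?i = "\<lambda>t. case t of Node a b c \<Rightarrow> (insertions a + insertions b, insertions a, a, b, c)"
    show "?i (?j x) = x" if "x \<in> ?S" for x
      using that by (auto simp: step_trees_eq)
    show "?j x \<in> step_trees (Suc n)" if "x \<in> ?S" for x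
      using that by (auto simp: step_trees_eq)
    show "?j (?i t) = t" if "t \<in> step_trees (Suc n)" for t
      using that by (auto simp: step_trees_eq split: ternary_tree.split)
    show "?i t \<in> ?S" if "t \<in> step_trees (Suc n)" for t
      using that by (auto simp: step_trees_eq split: ternary_tree.split)
    show "node_weight (\<lambda>a b c. f a * g b * h c) (?j x) = (\<lambda>(i, j, a, b, c). f a * g b * h c) x"
      if "x \<in> ?S" for x
      by (auto split: prod.split)
  qed
  finally show ?thesis by simp
qed

lemma tree_gf_node_weight:
  "tree_gf (node_weight (\<lambda>a b c. f a * g b * h c)) = fps_X * (tree_gf f * tree_gf g * tree_gf h)"
proof (rule fps_ext)
  fix n
  show "fps_nth (tree_gf (node_weight (\<lambda>a b c. f a * g b * h c))) n =
      fps_nth (fps_X * (tree_gf f * tree_gf g * tree_gf h)) n"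
    by (cases n) (simp_all add: tree_gf_nth step_trees_0 sum_step_trees_Suc del: fps_mult_nth)
qed

lemma tree_gf_add: "tree_gf (\<lambda>t. f t + g t) = tree_gf f + tree_gf g"
  by (rule fps_ext) (simp add: tree_gf_nth sum.distrib)

lemma tree_gf_at_Leaf: "tree_gf (\<lambda>t. if t = Leaf then 1 else 0) = 1"
proof (rule fps_ext)
  fix n
  have "Leaf \<in> step_trees n \<longleftrightarrow> n = 0" by (auto simp: step_trees_eq)
  then show "fps_nth (tree_gf (\<lambda>t. if t = Leaf then 1 else 0)) n = fps_nth 1 n"
    by (simp add: tree_gf_nth finite_step_trees)
qed

abbreviation tree_count_gf :: "real fps" where
  "tree_count_gf \<equiv> tree_gf (\<lambda>_. 1)"

lemma tree_count_gf_nth: "fps_nth tree_count_gf n = card (step_trees n)"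
  by (simp add: tree_gf_nth)

lemma tree_count_gf_nth_pos: "fps_nth tree_count_gf n > 0"
  using finite_step_trees step_trees_nonempty by (simp add: tree_count_gf_nth card_gt_0_iff)

lemma tree_count_gf_eq: "tree_count_gf = 1 + fps_X * tree_count_gf ^ 3"
proof -
  let ?w = "\<lambda>t. (if t = Leaf then 1 else 0) + node_weight (\<lambda>a b c. 1 * 1 * 1) t"
  have "1 = ?w t" for t
    by (cases t) auto
  then have "tree_count_gf = tree_gf ?w" by (intro arg_cong[of _ _ tree_gf] ext)
  also have "\<dots> = 1 + fps_X * tree_count_gf ^ 3"
    unfolding tree_gf_add tree_gf_node_weight tree_gf_at_Leaf by (simp add: power3_eq_cube)
  finally show ?thesis .
qed

text \<open>Each of the three children contributes \<open>w\<close> of one subtree while the other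
  two are arbitrary, which gives the factor \<open>3 * fps_X * tree_count_gf ^ 2\<close>. The toll
  \<open>v\<close> also carries the value at the leaf.\<close>

lemma tree_gf_additive:
  assumes "\<And>a b c. w (Node a b c) = w a + w b + w c + v (Node a b c)" "v Leaf = w Leaf"
  shows "tree_gf w = tree_gf v + 3 * fps_X * tree_count_gf ^ 2 * tree_gf w"
proof -
  let ?w = "\<lambda>t. (node_weight (\<lambda>a b c. w a * 1 * 1) t + node_weight (\<lambda>a b c. 1 * w b * 1) t) +
      (node_weight (\<lambda>a b c. 1 * 1 * w c) t + v t)"
  have "w t = ?w t" for t
    using assms by (cases t) auto
  then have "tree_gf w = tree_gf ?w" by (intro arg_cong[of _ _ tree_gf] ext)
  also have "\<dots> = tree_gf v + 3 * fps_X * tree_count_gf ^ 2 * tree_gf w"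
    unfolding tree_gf_add tree_gf_node_weight by (simp add: power2_eq_square algebra_simps)
  finally show ?thesis .
qed

section \<open>Additive functionals and the leaf count\<close>

abbreviation leaves_gf :: "real fps" where
  "leaves_gf \<equiv> tree_gf (\<lambda>t. real (leaves t))"

lemma leaves_gf_nth: "fps_nth leaves_gf n = (2 * real n + 1) * fps_nth tree_count_gf n"
  by (simp add: tree_gf_nth step_trees_eq leaves_eq_insertions)

lemma leaves_gf_eq: "leaves_gf = 1 + 3 * fps_X * tree_count_gf ^ 2 * leaves_gf"
proof -
  have "leaves_gf = tree_gf (\<lambda>t. if t = Leaf then 1 else 0) +
      3 * fps_X * tree_count_gf ^ 2 * leaves_gf"
    by (rule tree_gf_additive) auto
  then show ?thesis by (simp only: tree_gf_at_Leaf)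
qed

text \<open>The number of leaves is itself additive, with the indicator of \<open>Leaf\<close> as
  toll, so \<open>leaves_gf\<close> is the inverse of
  \<open>1 - 3 * fps_X * tree_count_gf ^ 2\<close>. Multiplication by it therefore solves the linear
  equation of every additive functional.\<close>

lemma tree_gf_additive_functional:
  assumes "\<And>a b c. w (Node a b c) = w a + w b + w c + v (Node a b c)" "v Leaf = w Leaf"
  shows "tree_gf w = tree_gf v * leaves_gf"
proof -
  define P :: "real fps" where "P = 3 * fps_X * tree_count_gf ^ 2"
  have w: "tree_gf w = tree_gf v + P * tree_gf w" unfolding P_def by (rule tree_gf_additive[OF assms])
  have l: "leaves_gf = 1 + P * leaves_gf" unfolding P_def by (rule leaves_gf_eq)
  have "leaves_gf - P * leaves_gf = 1" using l by (metis add_diff_cancel_right')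
  then have "tree_gf w = tree_gf w * (leaves_gf - P * leaves_gf)" by simp
  also have "\<dots> = (tree_gf w - P * tree_gf w) * leaves_gf" by (simp add: algebra_simps)
  also have "tree_gf w - P * tree_gf w = tree_gf v" using w by (metis add_diff_cancel_right')
  finally show ?thesis .
qed

section \<open>Asymptotic growth of the number of ternary trees\<close>

text \<open>An algebraic series satisfies a linear differential equation with polynomial
  coefficients, and comparing coefficients there gives the recurrence. \<open>D\<close> and
  \<open>E\<close> are the first and second Euler derivatives of \<open>A\<close>.\<close>

lemma tree_count_recurrence:
  "2 * (real n + 1) * (2 * real n + 3) * fps_nth tree_count_gf (Suc n) =
     3 * (3 * real n + 1) * (3 * real n + 2) * fps_nth tree_count_gf n"
proof -
  define A where "A = tree_count_gf"
  define D where "D = fps_X * fps_deriv A"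
  define E where "E = fps_X * fps_deriv D"
  \<comment> \<open>By the cubic equation, \<open>u\<close> is
    \<open>A * (1 - 3 * fps_X * A ^ 2)\<close>, the denominator that appears on differentiating;
    \<open>D\<close> equals \<open>A * (A - 1) / u\<close>.\<close>
  define u where "u = 3 - 2 * A"
  have A: "fps_X * A ^ 3 = A - 1" unfolding A_def using tree_count_gf_eq by (metis add_diff_cancel_left')
  have "fps_deriv A = A ^ 3 + fps_X * (3 * A ^ 2 * fps_deriv A)"
  proof -
    have "fps_deriv (A - 1) = fps_deriv (fps_X * A ^ 3)" using A by simp
    then show ?thesis by (simp add: fps_deriv_power' algebra_simps)
  qed
  then have "D = fps_X * A ^ 3 + 3 * fps_X * A ^ 2 * D"
    unfolding D_def by (metis (no_types, lifting) distrib_left mult.assoc mult.left_commute)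
  then have "A * D = A * (fps_X * A ^ 3 + 3 * fps_X * A ^ 2 * D)" by simp
  also have "\<dots> = A * (fps_X * A ^ 3) + 3 * (fps_X * A ^ 3) * D"
    by (simp add: algebra_simps power2_eq_square power3_eq_cube)
  finally have D: "u * D = A * (A - 1)"
    unfolding A u_def by (simp add: algebra_simps)
  have "fps_deriv u * D + u * fps_deriv D = fps_deriv A * (A - 1) + A * fps_deriv A"
    using arg_cong[OF D, of fps_deriv] by (simp add: algebra_simps)
  moreover have "fps_deriv u = - 2 * fps_deriv A"
    unfolding u_def by simp
  ultimately have "u * fps_deriv D = fps_deriv A * (2 * A - 1 + 2 * D)"
    by (simp add: algebra_simps)
  then have "fps_X * (u * fps_deriv D) = fps_X * (fps_deriv A * (2 * A - 1 + 2 * D))" by simp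
  also have "\<dots> = D * (2 * A - 1 + 2 * D)"
    unfolding D_def by (simp only: mult.assoc)
  finally have "u * E = D * (2 * A - 1 + 2 * D)"
    unfolding E_def by (simp only: mult.left_commute)
  then have "u ^ 3 * E = u ^ 2 * (D * (2 * A - 1 + 2 * D))"
    by (simp add: power2_eq_square power3_eq_cube)
  also have "\<dots> = (u * D) * (u * (2 * A - 1) + 2 * (u * D))"
    by (simp add: power2_eq_square algebra_simps)
  finally have E: "u ^ 3 * E = A * (A - 1) * (u * (2 * A - 1) + 2 * (A * (A - 1)))"
    unfolding D .
  have D': "u ^ 3 * D = u ^ 2 * (A * (A - 1))"
    unfolding D[symmetric] by (simp add: power2_eq_square power3_eq_cube)
  define Q where "Q = u * (2 * A - 1) + 2 * (A * (A - 1))"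
  \<comment> \<open>The bracket is the desired differential equation. The factor
    \<open>u ^ 3 * A ^ 3\<close> clears \<open>fps_X\<close> and all denominators and leaves a
    polynomial in \<open>A\<close> that vanishes identically. Both \<open>u\<close> and
    \<open>A\<close> have constant term 1 and can be cancelled.\<close>
  have "u ^ 3 * (A ^ 3 * (4 * E + 2 * D - fps_X * (27 * E + 27 * D + 6 * A))) =
      4 * A ^ 3 * (u ^ 3 * E) + 2 * A ^ 3 * (u ^ 3 * D)
        - (fps_X * A ^ 3) * (27 * (u ^ 3 * E) + 27 * (u ^ 3 * D) + 6 * u ^ 3 * A)"
    by (simp add: algebra_simps)
  also have "\<dots> = A * (A - 1) *
      (4 * A ^ 3 * Q + 2 * A ^ 3 * u ^ 2 - 27 * (A - 1) * (Q + u ^ 2) - 6 * u ^ 3)"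
    unfolding A E D' Q_def[symmetric] by (simp add: algebra_simps)
  also have "4 * A ^ 3 * Q + 2 * A ^ 3 * u ^ 2 - 27 * (A - 1) * (Q + u ^ 2) - 6 * u ^ 3 = 0"
    unfolding Q_def u_def by (simp add: algebra_simps power2_eq_square power3_eq_cube)
  finally have "u = 0 \<or> A = 0 \<or> 4 * E + 2 * D = fps_X * (27 * E + 27 * D + 6 * A)" by simp
  moreover have "fps_nth A 0 = 1" by (simp add: A_def tree_gf_nth step_trees_0)
  moreover from this have "fps_nth u 0 = 1" by (simp add: u_def fps_numeral_nth)
  ultimately have "4 * E + 2 * D = fps_X * (27 * E + 27 * D + 6 * A)"
    by fastforce
  then have "fps_nth (4 * E + 2 * D) (Suc n) = fps_nth (27 * E + 27 * D + 6 * A) n"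
    by (metis fps_X_mult_nth nat.distinct(1) diff_Suc_1)
  then have "4 * fps_nth E (Suc n) + 2 * fps_nth D (Suc n) =
      27 * fps_nth E n + 27 * fps_nth D n + 6 * fps_nth A n"
    by (simp add: numeral_fps_const)
  moreover have "fps_nth D k = real k * fps_nth A k" for k
    unfolding D_def by (cases k) auto
  moreover from this have "fps_nth E k = (real k)\<^sup>2 * fps_nth A k" for k
    unfolding E_def by (cases k) (auto simp: power2_eq_square algebra_simps)
  ultimately show ?thesis
    by (simp add: A_def[symmetric] algebra_simps power2_eq_square)
qed

section \<open>Two-sided bounds after division by the growth rate (27/4)^n\<close>

definition tree_count_scaled :: "nat \<Rightarrow> real" where
  "tree_count_scaled n = fps_nth tree_count_gf n * (4 / 27) ^ n"

lemma tree_count_scaled_Suc: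
  "9 * (real n + 1) * (2 * real n + 3) * tree_count_scaled (Suc n) =
     2 * (3 * real n + 1) * (3 * real n + 2) * tree_count_scaled n"
proof -
  let ?A = "fps_nth tree_count_gf"
  have "9 * (real n + 1) * (2 * real n + 3) * (?A (Suc n) * (4 / 27) ^ Suc n) =
      (2 * (real n + 1) * (2 * real n + 3) * ?A (Suc n)) * ((2 / 3) * (4 / 27) ^ n)"
    by simp
  also have "\<dots> = 2 * (3 * real n + 1) * (3 * real n + 2) * (?A n * (4 / 27) ^ n)"
    unfolding tree_count_recurrence by simp
  finally show ?thesis by (simp only: tree_count_scaled_def)
qed

lemma tree_count_scaled_0: "tree_count_scaled 0 = 1"
  by (simp add: tree_count_scaled_def tree_gf_nth step_trees_0)

lemma tree_count_scaled_pos: "tree_count_scaled n > 0"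
  by (simp add: tree_count_scaled_def tree_count_gf_nth_pos)

text \<open>Squaring turns the decay n^(-3/2) into an integer power, so the induction step becomes a
  polynomial inequality, and the difference of its two sides has only positive coefficients.\<close>

lemma tree_count_scaled_upper: "(tree_count_scaled n)\<^sup>2 * (real n + 1) ^ 3 \<le> 1"
proof (induction n)
  case (Suc n)
  define x where "x = real n"
  define p where "p = 9 * (x + 1) * (2 * x + 3)"
  define q where "q = 2 * (3 * x + 1) * (3 * x + 2)"
  have x: "x \<ge> 0" by (simp add: x_def)
  then have p: "p > 0" unfolding p_def by simp
  have poly: "q\<^sup>2 * (x + 2) ^ 3 \<le> p\<^sup>2 * (x + 1) ^ 3"
  proof -
    have "p\<^sup>2 * (x + 1) ^ 3 = q\<^sup>2 * (x + 2) ^ 3 +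
        (601 + 3273 * x + 6906 * x ^ 2 + 6950 * x ^ 3 + 3285 * x ^ 4 + 585 * x ^ 5)"
      unfolding p_def q_def by (simp add: algebra_simps eval_nat_numeral)
    then show ?thesis using x by simp
  qed
  have "p\<^sup>2 * ((tree_count_scaled (Suc n))\<^sup>2 * (x + 2) ^ 3) =
      (p * tree_count_scaled (Suc n))\<^sup>2 * (x + 2) ^ 3"
    by (simp add: power_mult_distrib)
  also have "\<dots> = (tree_count_scaled n)\<^sup>2 * (q\<^sup>2 * (x + 2) ^ 3)"
    unfolding p_def q_def x_def tree_count_scaled_Suc by (simp add: power_mult_distrib)
  also have "\<dots> \<le> (tree_count_scaled n)\<^sup>2 * (p\<^sup>2 * (x + 1) ^ 3)"
    by (intro mult_left_mono poly) simp
  also have "\<dots> = p\<^sup>2 * ((tree_count_scaled n)\<^sup>2 * (x + 1) ^ 3)" by simp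
  also have "\<dots> \<le> p\<^sup>2 * 1"
    using Suc by (intro mult_left_mono) (auto simp: x_def)
  finally show ?case using p by (simp add: x_def add.commute)
qed (simp add: tree_count_scaled_0)

text \<open>Up to the factor 27 the cube is that of n + 1/3. The shift 1/3 in place of 1 reverses
  the polynomial inequality of the upper bound, while the product is still 1 at n = 0.\<close>

lemma tree_count_scaled_lower: "(tree_count_scaled n)\<^sup>2 * (3 * real n + 1) ^ 3 \<ge> 1"
proof (induction n)
  case (Suc n)
  define x where "x = real n"
  define p where "p = 9 * (x + 1) * (2 * x + 3)"
  define q where "q = 2 * (3 * x + 1) * (3 * x + 2)"
  have x: "x \<ge> 0" by (simp add: x_def)
  then have p: "p > 0" unfolding p_def by simp
  have poly: "p\<^sup>2 * (3 * x + 1) ^ 3 \<le> q\<^sup>2 * (3 * x + 4) ^ 3"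
  proof -
    have "q\<^sup>2 * (3 * x + 4) ^ 3 = p\<^sup>2 * (3 * x + 1) ^ 3 +
        (295 + 2529 * x + 7866 * x ^ 2 + 10962 * x ^ 3 + 7047 * x ^ 4 + 1701 * x ^ 5)"
      unfolding p_def q_def by (simp add: algebra_simps eval_nat_numeral)
    then show ?thesis using x by simp
  qed
  have "p\<^sup>2 * 1 \<le> p\<^sup>2 * ((tree_count_scaled n)\<^sup>2 * (3 * x + 1) ^ 3)"
    using Suc by (intro mult_left_mono) (auto simp: x_def)
  also have "\<dots> = (tree_count_scaled n)\<^sup>2 * (p\<^sup>2 * (3 * x + 1) ^ 3)" by simp
  also have "\<dots> \<le> (tree_count_scaled n)\<^sup>2 * (q\<^sup>2 * (3 * x + 4) ^ 3)"
    by (intro mult_left_mono poly) simp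
  also have "\<dots> = (p * tree_count_scaled (Suc n))\<^sup>2 * (3 * x + 4) ^ 3"
    unfolding p_def q_def x_def tree_count_scaled_Suc by (simp add: power_mult_distrib)
  also have "\<dots> = p\<^sup>2 * ((tree_count_scaled (Suc n))\<^sup>2 * (3 * x + 4) ^ 3)"
    by (simp add: power_mult_distrib)
  finally show ?case using p by (simp add: x_def algebra_simps)
qed (simp add: tree_count_scaled_0)

lemma tree_count_eq_scaled: "fps_nth tree_count_gf n = tree_count_scaled n * (27 / 4) ^ n"
  by (simp add: tree_count_scaled_def field_simps)

lemma powr_three_halves_squared: "x > 0 \<Longrightarrow> (x powr (3 / 2))\<^sup>2 = x ^ 3" for x :: real
  by (simp add: powr_power powr_numeral)

lemma tree_count_upper: "fps_nth tree_count_gf n \<le> (27 / 4) ^ n * (real n + 1) powr (- 3 / 2)"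
proof -
  let ?p = "(real n + 1) powr (3 / 2)"
  have "(tree_count_scaled n * ?p)\<^sup>2 \<le> 1\<^sup>2"
    using tree_count_scaled_upper[of n] by (simp add: power_mult_distrib powr_three_halves_squared)
  then have "tree_count_scaled n * ?p \<le> 1"
    by (rule power2_le_imp_le) simp
  then have "tree_count_scaled n \<le> (real n + 1) powr (- 3 / 2)"
    by (simp add: powr_minus_divide field_simps)
  then show ?thesis by (simp add: tree_count_eq_scaled)
qed

lemma tree_count_lower: "fps_nth tree_count_gf n \<ge> (27 / 4) ^ n * (real n + 1) powr (- 3 / 2) / 6"
proof -
  let ?p = "(real n + 1) powr (3 / 2)"
  have "1 \<le> (tree_count_scaled n)\<^sup>2 * (3 * real n + 1) ^ 3"
    by (rule tree_count_scaled_lower)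
  also have "\<dots> \<le> (tree_count_scaled n)\<^sup>2 * (3 * (real n + 1)) ^ 3"
    by (intro mult_left_mono power_mono) auto
  also have "(3 * (real n + 1)) ^ 3 = 27 * (real n + 1) ^ 3"
    by (simp only: power_mult_distrib) simp
  also have "(tree_count_scaled n)\<^sup>2 * (27 * (real n + 1) ^ 3) = 27 * (tree_count_scaled n * ?p)\<^sup>2"
    by (simp add: power_mult_distrib powr_three_halves_squared)
  \<comment> \<open>The bound 1/27 is weakened to 1/36, which has a rational root.\<close>
  finally have "(1 / 6)\<^sup>2 \<le> (tree_count_scaled n * ?p)\<^sup>2" by (simp add: power2_eq_square)
  then have "1 / 6 \<le> tree_count_scaled n * ?p"
    by (rule power2_le_imp_le) (simp add: tree_count_scaled_pos less_imp_le)
  then have "tree_count_scaled n \<ge> (real n + 1) powr (- 3 / 2) / 6"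
    by (simp add: powr_minus_divide field_simps)
  then show ?thesis by (simp add: tree_count_eq_scaled field_simps)
qed

section \<open>Convolution with a square-root decay\<close>

lemma sum_inverse_sqrt_le: "(\<Sum>i=0..n. 1 / sqrt (real i + 1)) \<le> 2 * sqrt (real n + 1)"
proof (induction n)
  case (Suc n)
  let ?a = "sqrt (real n + 1)" and ?b = "sqrt (real n + 2)"
  have b: "?b > 0" by simp
  have "2 * ?a * ?b \<le> ?a\<^sup>2 + ?b\<^sup>2" using sum_squares_bound[of ?a ?b] by simp
  then have "2 * ?a * ?b + 1 \<le> 2 * (?b * ?b)" by simp
  then have "2 * ?a + 1 / ?b \<le> 2 * ?b" using b by (simp add: field_simps)
  then show ?case using Suc by (simp add: add.commute)
qed simp

text \<open>Either \<open>n - i\<close> is at least about half of \<open>n\<close>, and the second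
  factor is of order n^(-1/2), or \<open>i\<close> is, and the first factor is at most
  \<open>2 / (real n + 1)\<close>. Adding both bounds removes the case distinction from the
  sum.\<close>

lemma convolution_pointwise:
  assumes "i \<le> n"
  shows "(real i + 1) powr (- 11 / 10) * (real (n - i) + 1) powr (- 1 / 2) \<le>
    (real n + 1) powr (- 1 / 2) * (2 * (real i + 1) powr (- 11 / 10)) +
    2 / (real n + 1) * (1 / sqrt (real (n - i) + 1))"
proof -
  let ?f = "(real i + 1) powr (- 11 / 10)" and ?g = "(real (n - i) + 1) powr (- 1 / 2)"
  have g: "?g = 1 / sqrt (real (n - i) + 1)"
    by (simp add: powr_minus_divide powr_half_sqrt)
  show ?thesis
  proof (cases "real n + 1 \<le> 2 * (real (n - i) + 1)")
    case True
    have "?g \<le> ((real n + 1) / 2) powr (- 1 / 2)"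
      using True by (intro powr_mono2') auto
    also have "\<dots> = (real n + 1) powr (- 1 / 2) * 2 powr (1 / 2)"
      by (simp add: powr_divide powr_minus_divide)
    also have "\<dots> \<le> (real n + 1) powr (- 1 / 2) * 2 powr 1"
      by (intro mult_left_mono powr_mono) auto
    finally have "?f * ?g \<le> ?f * ((real n + 1) powr (- 1 / 2) * 2)"
      by (intro mult_left_mono) auto
    also have "\<dots> \<le> (real n + 1) powr (- 1 / 2) * (2 * ?f) + 2 / (real n + 1) * (1 / sqrt (real (n - i) + 1))"
      by simp
    finally show ?thesis .
  next
    case False
    then have "real n + 1 \<le> 2 * (real i + 1)" using assms by (simp add: of_nat_diff)
    have "?f \<le> (real i + 1) powr (- 1)" by (intro powr_mono) auto
    also have "\<dots> = 1 / (real i + 1)" by (simp add: powr_minus_divide)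
    also have "\<dots> \<le> 2 / (real n + 1)"
      using \<open>real n + 1 \<le> 2 * (real i + 1)\<close> by (simp add: field_simps)
    finally have "?f * ?g \<le> 2 / (real n + 1) * ?g"
      by (intro mult_right_mono) auto
    also have "\<dots> \<le> (real n + 1) powr (- 1 / 2) * (2 * ?f) + 2 / (real n + 1) * (1 / sqrt (real (n - i) + 1))"
      unfolding g by simp
    finally show ?thesis .
  qed
qed

text \<open>The exponent -11/10 is summable, which handles the first term of the pointwise bound.
  The second sums to order n^(-1) times n^(1/2).\<close>

lemma convolution_powr_bound:
  obtains C :: real where "C > 0"
    "\<And>n. (\<Sum>i=0..n. (real i + 1) powr (- 11 / 10) * (real (n - i) + 1) powr (- 1 / 2))
       \<le> C * (real n + 1) powr (- 1 / 2)"
proof -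
  define f where "f = (\<lambda>i::nat. (real i + 1) powr (- 11 / 10))"
  have "summable (\<lambda>i. real (Suc i) powr (- 11 / 10))"
    using summable_real_powr_iff[of "- 11 / 10"] by (subst summable_Suc_iff) simp
  then have f: "summable f" unfolding f_def by (simp add: add.commute)
  define S where "S = suminf f"
  have S: "(\<Sum>i=0..n. f i) \<le> S" for n
    unfolding S_def using f by (intro sum_le_suminf) (auto simp: f_def)
  have S0: "S \<ge> 0" unfolding S_def using f by (intro suminf_nonneg) (auto simp: f_def)
  show ?thesis
  proof (rule that)
    show "2 * S + 4 > 0" using S0 by simp
    fix n
    have "(\<Sum>i=0..n. f i * (real (n - i) + 1) powr (- 1 / 2)) \<le>
      (\<Sum>i=0..n. (real n + 1) powr (- 1 / 2) * (2 * f i) + 2 / (real n + 1) * (1 / sqrt (real (n - i) + 1)))"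
      unfolding f_def by (intro sum_mono convolution_pointwise) auto
    also have "\<dots> = (real n + 1) powr (- 1 / 2) * (2 * (\<Sum>i=0..n. f i)) +
        2 / (real n + 1) * (\<Sum>i=0..n. 1 / sqrt (real (n - i) + 1))"
      by (simp only: sum.distrib sum_distrib_left)
    also have "(\<Sum>i=0..n. 1 / sqrt (real (n - i) + 1)) = (\<Sum>i=0..n. 1 / sqrt (real i + 1))"
      using sum.nat_diff_reindex[of "\<lambda>i. 1 / sqrt (real i + 1)" "Suc n"]
      by (simp add: atLeast0AtMost lessThan_Suc_atMost)
    also have "(real n + 1) powr (- 1 / 2) * (2 * (\<Sum>i=0..n. f i)) +
        2 / (real n + 1) * (\<Sum>i=0..n. 1 / sqrt (real i + 1)) \<le>
        (real n + 1) powr (- 1 / 2) * (2 * S) + 2 / (real n + 1) * (2 * sqrt (real n + 1))"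
      by (intro add_mono mult_left_mono S sum_inverse_sqrt_le) auto
    also have "2 / (real n + 1) * (2 * sqrt (real n + 1)) = (real n + 1) powr (- 1 / 2) * 4"
      by (simp add: powr_minus_divide powr_half_sqrt field_simps real_sqrt_mult_self)
    finally show "(\<Sum>i=0..n. (real i + 1) powr (- 11 / 10) * (real (n - i) + 1) powr (- 1 / 2))
        \<le> (2 * S + 4) * (real n + 1) powr (- 1 / 2)"
      unfolding f_def by (simp add: algebra_simps)
  qed
qed

text \<open>Nonnegativity is included so that Cauchy products can be estimated term by term.\<close>

definition fps_bounded :: "real \<Rightarrow> real \<Rightarrow> real \<Rightarrow> real fps \<Rightarrow> bool" where
  "fps_bounded C r e F \<longleftrightarrow>
     (\<forall>n. 0 \<le> fps_nth F n \<and> fps_nth F n \<le> C * (r ^ n * (real n + 1) powr e))"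

lemma fps_bounded_mult:
  obtains C :: real where "C > 0"
    "\<And>a b r F G. fps_bounded a r (- 11 / 10) F \<Longrightarrow> fps_bounded b r (- 1 / 2) G \<Longrightarrow>
       r > 0 \<Longrightarrow> fps_bounded (a * b * C) r (- 1 / 2) (F * G)"
proof -
  obtain C :: real where C: "C > 0"
    "\<And>n. (\<Sum>i=0..n. (real i + 1) powr (- 11 / 10) * (real (n - i) + 1) powr (- 1 / 2))
       \<le> C * (real n + 1) powr (- 1 / 2)"
    using convolution_powr_bound by blast
  have "fps_bounded (a * b * C) r (- 1 / 2) (F * G)"
    if F: "fps_bounded a r (- 11 / 10) F" and G: "fps_bounded b r (- 1 / 2) G" and r: "r > 0"
    for a b r F G
    unfolding fps_bounded_def
  proof (intro allI conjI)
    fix n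
    show "0 \<le> fps_nth (F * G) n"
      using F G unfolding fps_mult_nth fps_bounded_def by (auto intro!: sum_nonneg)
    have "0 \<le> a" "0 \<le> b"
      using F G unfolding fps_bounded_def by (auto dest!: spec[of _ 0])
    note FG = F[unfolded fps_bounded_def, rule_format] G[unfolded fps_bounded_def, rule_format]
    have "fps_nth (F * G) n \<le> (\<Sum>i=0..n. (a * (r ^ i * (real i + 1) powr (- 11 / 10))) *
        (b * (r ^ (n - i) * (real (n - i) + 1) powr (- 1 / 2))))"
      unfolding fps_mult_nth using \<open>0 \<le> a\<close> r
      by (intro sum_mono mult_mono FG[THEN conjunct1] FG[THEN conjunct2]) auto
    also have "\<dots> = (\<Sum>i=0..n. a * b * r ^ n *
        ((real i + 1) powr (- 11 / 10) * (real (n - i) + 1) powr (- 1 / 2)))"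
    proof (intro sum.cong refl)
      fix i assume "i \<in> {0..n}"
      then have "r ^ n = r ^ i * r ^ (n - i)" by (simp flip: power_add)
      then show "(a * (r ^ i * (real i + 1) powr (- 11 / 10))) *
          (b * (r ^ (n - i) * (real (n - i) + 1) powr (- 1 / 2))) =
          a * b * r ^ n * ((real i + 1) powr (- 11 / 10) * (real (n - i) + 1) powr (- 1 / 2))"
        by simp
    qed
    also have "\<dots> \<le> a * b * r ^ n * (C * (real n + 1) powr (- 1 / 2))"
      unfolding sum_distrib_left[symmetric] using \<open>0 \<le> a\<close> \<open>0 \<le> b\<close> r
      by (intro mult_left_mono C) auto
    finally show "fps_nth (F * G) n \<le> a * b * C * (r ^ n * (real n + 1) powr (- 1 / 2))"
      by (simp add: algebra_simps)
  qed
  then show ?thesis using that C(1) by blast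
qed

section \<open>The loss caused by large discarded subtrees\<close>

text \<open>The minimum is the size of the subtree to be discarded. It counts only at nodes with two
  children above the threshold, since elsewhere the discarded weight is charged to the kept
  part.\<close>

definition toll :: "nat \<Rightarrow> ternary_tree \<Rightarrow> ternary_tree \<Rightarrow> ternary_tree \<Rightarrow> real" where
  "toll K a b c =
     (if K < leaves a \<and> K < leaves b \<or> K < leaves a \<and> K < leaves c \<or> K < leaves b \<and> K < leaves c
      then real (min (leaves a) (min (leaves b) (leaves c))) else 0)"

fun loss :: "nat \<Rightarrow> ternary_tree \<Rightarrow> real" where
  "loss K Leaf = 0"
| "loss K (Node a b c) = loss K a + loss K b + loss K c + toll K a b c"

lemma toll_nonneg: "toll K a b c \<ge> 0"
  by (simp add: toll_def)

lemma loss_nonneg: "loss K t \<ge> 0"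
  by (induction t) (auto simp: toll_nonneg)

lemma leaves_pos: "leaves t > 0"
  by (induction t) auto

text \<open>
  Of two children with at most \<open>K\<close> leaves each, at least half of the weight \<open>h\<close> is kept.
  Only when two children are large can the discarded one not be charged to what remains.
\<close>

lemma binary_leaves_ge_additive:
  fixes h :: "ternary_tree \<Rightarrow> real" and \<theta> :: real
  assumes small: "\<And>t. leaves t \<le> K \<Longrightarrow> 0 \<le> h t \<and> h t \<le> binary_leaves t"
    and add: "\<And>a b c. leaves (Node a b c) > K \<Longrightarrow> h (Node a b c) = h a + h b + h c"
    and le: "\<And>t. h t \<le> \<theta> * leaves t"
    and K: "K \<ge> 1" and \<theta>: "\<theta> \<ge> 0"
  shows "3 * real (binary_leaves t) \<ge> h t - \<theta> * loss K t"
proof (induction t)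
  case Leaf
  then show ?case using small[of Leaf] K by simp
next
  case (Node a b c)
  show ?case
  proof (cases "leaves (Node a b c) \<le> K")
    case True
    have "\<theta> * loss K (Node a b c) \<ge> 0" using \<theta> loss_nonneg by (intro mult_nonneg_nonneg)
    then show ?thesis using small[OF True] by linarith
  next
    case False
    have h: "h (Node a b c) = h a + h b + h c" using add False by simp
    have nonneg: "\<theta> * loss K a \<ge> 0" "\<theta> * loss K b \<ge> 0" "\<theta> * loss K c \<ge> 0" "\<theta> * toll K a b c \<ge> 0"
      using \<theta> loss_nonneg toll_nonneg by (auto intro: mult_nonneg_nonneg)
    have loss: "\<theta> * loss K (Node a b c) = \<theta> * loss K a + \<theta> * loss K b + \<theta> * loss K c + \<theta> * toll K a b c"
      by (simp add: algebra_simps)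
    let ?B = "real (binary_leaves (Node a b c))"
    have B: "?B \<ge> real (binary_leaves a) + real (binary_leaves b)"
      "?B \<ge> real (binary_leaves a) + real (binary_leaves c)"
      "?B \<ge> real (binary_leaves b) + real (binary_leaves c)"
      by (simp_all add: max_def)
    show ?thesis
    proof (cases "K < leaves a \<and> K < leaves b \<or> K < leaves a \<and> K < leaves c \<or> K < leaves b \<and> K < leaves c")
      case True
      \<comment> \<open>The child attaining the minimum is dropped: its \<open>h\<close> is at most
        \<open>\<theta>\<close> times its leaves, which is the toll. The induction hypothesis covers
        the other two.\<close>
      then have "\<theta> * toll K a b c = \<theta> * leaves a \<or> \<theta> * toll K a b c = \<theta> * leaves b \<or>
          \<theta> * toll K a b c = \<theta> * leaves c"
        by (auto simp: toll_def min_def)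
      then show ?thesis
        using h loss B nonneg Node le[of a] le[of b] le[of c] by linarith
    next
      case False
      \<comment> \<open>At least two children are small. Keeping the third and the better of these
        two suffices, because three times the larger \<open>binary_leaves\<close> exceeds the sum of
        their \<open>h\<close>.\<close>
      have s: "K < leaves t \<or> 0 \<le> h t \<and> h t \<le> real (binary_leaves t)" for t
        using small[of t] by linarith
      show ?thesis
        using False h loss B nonneg Node s[of a] s[of b] s[of c] by smt
    qed
  qed
qed

text \<open>Three exponents 2/5 add up to 1 + 1/5. The surplus 1/5 is taken from the two factors
  that are at least \<open>K\<close> and becomes the gain K^(-1/5). An exponent below 1/2 keeps the
  tree counts weighted by it summable after scaling.\<close>

lemma toll_bound_aux:
  fixes K p q s :: real
  assumes "K > 0" "s > 0" "s \<le> p" "s \<le> q" "K \<le> p" "K \<le> q"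
  shows "s \<le> K powr (- 1 / 5) * (p powr (2 / 5) * q powr (2 / 5) * s powr (2 / 5))"
proof -
  have pow: "x powr (2 / 5) \<ge> s powr (3 / 10) * K powr (1 / 10)" if "s \<le> x" "K \<le> x" for x
  proof -
    have "s powr (3 / 10) * K powr (1 / 10) \<le> x powr (3 / 10) * x powr (1 / 10)"
      using that assms by (intro mult_mono powr_mono2) auto
    also have "\<dots> = x powr (2 / 5)" by (simp flip: powr_add)
    finally show ?thesis .
  qed
  have "K powr (- 1 / 5) * ((s powr (3 / 10) * K powr (1 / 10)) * (s powr (3 / 10) * K powr (1 / 10)) * s powr (2 / 5))
      = K powr (- 1 / 5 + 1 / 10 + 1 / 10) * s powr (3 / 10 + 3 / 10 + 2 / 5)"
    unfolding powr_add by (simp only: mult_ac)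
  then have "s = K powr (- 1 / 5) * ((s powr (3 / 10) * K powr (1 / 10)) * (s powr (3 / 10) * K powr (1 / 10)) * s powr (2 / 5))"
    using assms by simp
  also have "\<dots> \<le> K powr (- 1 / 5) * (p powr (2 / 5) * q powr (2 / 5) * s powr (2 / 5))"
    using pow[of p] pow[of q] assms by (intro mult_left_mono mult_right_mono mult_mono) auto
  finally show ?thesis .
qed

text \<open>The toll itself does not factor over the three subtrees; this bound does, so its
  generating function is a product.\<close>

lemma toll_le:
  assumes "K > 0"
  shows "toll K a b c \<le> real K powr (- 1 / 5) *
    (leaves a powr (2 / 5) * leaves b powr (2 / 5) * leaves c powr (2 / 5))"
proof (cases "K < leaves a \<and> K < leaves b \<or> K < leaves a \<and> K < leaves c \<or> K < leaves b \<and> K < leaves c")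
  case True
  have pos: "real (leaves a) > 0" "real (leaves b) > 0" "real (leaves c) > 0"
    using leaves_pos by auto
  consider "leaves a \<le> leaves b" "leaves a \<le> leaves c" | "leaves b \<le> leaves a" "leaves b \<le> leaves c"
    | "leaves c \<le> leaves a" "leaves c \<le> leaves b"
    by linarith
  then show ?thesis
  proof cases
    case 1
    then have "toll K a b c = leaves a" "K \<le> leaves b" "K \<le> leaves c"
      using True by (auto simp: toll_def)
    then show ?thesis
      using toll_bound_aux[of K "leaves a" "leaves b" "leaves c"] assms pos 1 by (simp add: mult_ac)
  next
    case 2
    then have "toll K a b c = leaves b" "K \<le> leaves a" "K \<le> leaves c"
      using True by (auto simp: toll_def)
    then show ?thesis
      using toll_bound_aux[of K "leaves b" "leaves a" "leaves c"] assms pos 2 by (simp add: mult_ac)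
  next
    case 3
    then have "toll K a b c = leaves c" "K \<le> leaves a" "K \<le> leaves b"
      using True by (auto simp: toll_def)
    then show ?thesis
      using toll_bound_aux[of K "leaves c" "leaves a" "leaves b"] assms pos 3 by (simp add: mult_ac)
  qed
next
  case False
  then have "toll K a b c = 0" by (auto simp: toll_def)
  then show ?thesis by simp
qed

section \<open>Coefficient bounds and the mean of the loss\<close>

lemma fps_bounded_X: "fps_bounded 1 (27 / 4) (- 11 / 10) (fps_X :: real fps)"
proof -
  have "(1 :: real) \<le> 27 / 4 * (2 powr (- 2))" by (simp add: powr_minus_divide)
  also have "\<dots> \<le> 27 / 4 * (2 powr (- 11 / 10))" by (intro mult_left_mono powr_mono) auto
  finally show ?thesis by (auto simp: fps_bounded_def fps_X_def)
qed

lemma fps_bounded_leaves: "fps_bounded 2 (27 / 4) (- 1 / 2) leaves_gf"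
  unfolding fps_bounded_def
proof (intro allI conjI)
  fix n
  show "0 \<le> fps_nth leaves_gf n" by (simp add: tree_gf_nth sum_nonneg)
  have "fps_nth leaves_gf n \<le> (2 * (real n + 1)) * ((27 / 4) ^ n * (real n + 1) powr (- 3 / 2))"
    unfolding leaves_gf_nth by (intro mult_mono tree_count_upper) (auto simp: tree_count_gf_nth_pos less_imp_le)
  also have "\<dots> = 2 * ((27 / 4) ^ n * ((real n + 1) powr 1 * (real n + 1) powr (- 3 / 2)))"
    by simp
  also have "\<dots> = 2 * ((27 / 4) ^ n * (real n + 1) powr (- 1 / 2))"
    unfolding powr_add[symmetric] by simp
  finally show "fps_nth leaves_gf n \<le> 2 * ((27 / 4) ^ n * (real n + 1) powr (- 1 / 2))" .
qed

lemma leaves_gf_lower: "fps_nth leaves_gf n \<ge> (27 / 4) ^ n * (real n + 1) powr (- 1 / 2) / 6"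
proof -
  have "(27 / 4) ^ n * (real n + 1) powr (- 1 / 2) / 6 =
      (27 / 4) ^ n * ((real n + 1) powr 1 * (real n + 1) powr (- 3 / 2)) / 6"
    unfolding powr_add[symmetric] by simp
  also have "\<dots> = (real n + 1) * ((27 / 4) ^ n * (real n + 1) powr (- 3 / 2) / 6)" by simp
  also have "\<dots> \<le> (2 * real n + 1) * fps_nth tree_count_gf n"
    by (intro mult_mono tree_count_lower) auto
  finally show ?thesis by (simp only: leaves_gf_nth)
qed

lemma fps_bounded_leaves_powr:
  "fps_bounded 2 (27 / 4) (- 11 / 10) (tree_gf (\<lambda>t. real (leaves t) powr (2 / 5)))"
  unfolding fps_bounded_def
proof (intro allI conjI)
  fix n
  let ?B = "tree_gf (\<lambda>t. real (leaves t) powr (2 / 5))"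
  show "0 \<le> fps_nth ?B n" by (simp add: tree_gf_nth sum_nonneg)
  have "fps_nth ?B n = (2 * real n + 1) powr (2 / 5) * fps_nth tree_count_gf n"
    by (simp add: tree_gf_nth step_trees_eq leaves_eq_insertions add.commute)
  also have "\<dots> \<le> (2 * (real n + 1)) powr (2 / 5) * ((27 / 4) ^ n * (real n + 1) powr (- 3 / 2))"
    by (intro mult_mono tree_count_upper powr_mono2) (auto simp: tree_count_gf_nth_pos less_imp_le)
  also have "\<dots> = 2 powr (2 / 5) * ((27 / 4) ^ n * ((real n + 1) powr (2 / 5) * (real n + 1) powr (- 3 / 2)))"
  proof -
    have "(2 * (real n + 1)) powr (2 / 5) = 2 powr (2 / 5) * (real n + 1) powr (2 / 5)"
      by (rule powr_mult)
    then show ?thesis by (simp only: mult_ac)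
  qed
  also have "\<dots> = 2 powr (2 / 5) * ((27 / 4) ^ n * (real n + 1) powr (- 11 / 10))"
    unfolding powr_add[symmetric] by simp
  also have "\<dots> \<le> 2 powr 1 * ((27 / 4) ^ n * (real n + 1) powr (- 11 / 10))"
    by (intro mult_right_mono powr_mono) auto
  finally show "fps_nth ?B n \<le> 2 * ((27 / 4) ^ n * (real n + 1) powr (- 11 / 10))" by simp
qed

lemma fps_mult_nth_mono:
  fixes F G H :: "real fps"
  assumes "\<And>k. k \<le> n \<Longrightarrow> fps_nth F k \<le> fps_nth G k" "\<And>k. 0 \<le> fps_nth H k"
  shows "fps_nth (F * H) n \<le> fps_nth (G * H) n"
  unfolding fps_mult_nth using assms by (intro sum_mono mult_right_mono) auto

text \<open>The loss is additive, so its series is that of the toll times \<open>leaves_gf\<close>.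
  The toll contributes only factors with summable exponent -11/10, which preserve the order n^(-1/2)
  of \<open>leaves_gf\<close>; the total number of leaves has this same order.\<close>

lemma mean_loss_le:
  obtains C :: real where "C > 0"
    "\<And>K n. K > 0 \<Longrightarrow>
      (\<Sum>t\<in>step_trees n. loss K t) \<le> C * real K powr (- 1 / 5) * (\<Sum>t\<in>step_trees n. real (leaves t))"
proof -
  obtain C :: real where C: "C > 0"
    "\<And>a b r F G. fps_bounded a r (- 11 / 10) F \<Longrightarrow> fps_bounded b r (- 1 / 2) G \<Longrightarrow>
       r > 0 \<Longrightarrow> fps_bounded (a * b * C) r (- 1 / 2) (F * G)"
    using fps_bounded_mult by blast
  let ?B = "tree_gf (\<lambda>t. real (leaves t) powr (2 / 5))"
  \<comment> \<open>The product is bracketed so that the multiplication bound applies from the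
    inside out, starting from \<open>leaves_gf\<close>.\<close>
  define P where "P = fps_X * (?B * (?B * (?B * leaves_gf)))"
  define D where "D = 1 * (2 * (2 * (2 * 2 * C) * C) * C) * C"
  have P: "fps_bounded D (27 / 4) (- 1 / 2) P"
    unfolding P_def D_def
    by (intro C fps_bounded_X fps_bounded_leaves_powr fps_bounded_leaves) auto
  have D: "D > 0" unfolding D_def using C(1) by simp
  show ?thesis
  proof (rule that)
    show "6 * D > 0" using D by simp
    fix K n :: nat
    assume K: "K > 0"
    define k where "k = real K powr (- 1 / 5)"
    have "tree_gf (loss K) = tree_gf (node_weight (toll K)) * leaves_gf"
      by (rule tree_gf_additive_functional) auto
    then have "(\<Sum>t\<in>step_trees n. loss K t) = fps_nth (tree_gf (node_weight (toll K)) * leaves_gf) n"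
      by (simp flip: tree_gf_nth)
    also have "\<dots> \<le> fps_nth (fps_const k * (fps_X * (?B * ?B * ?B)) * leaves_gf) n"
    proof (rule fps_mult_nth_mono)
      show "0 \<le> fps_nth leaves_gf m" for m by (simp add: tree_gf_nth sum_nonneg)
      show "fps_nth (tree_gf (node_weight (toll K))) m \<le> fps_nth (fps_const k * (fps_X * (?B * ?B * ?B))) m" for m
      proof -
        let ?f = "\<lambda>t. real (leaves t) powr (2 / 5)"
        have "node_weight (toll K) t \<le> k * node_weight (\<lambda>a b c. ?f a * ?f b * ?f c) t" for t
          using toll_le[OF K] by (cases t) (auto simp: k_def)
        then have "fps_nth (tree_gf (node_weight (toll K))) m \<le>
            k * fps_nth (tree_gf (node_weight (\<lambda>a b c. ?f a * ?f b * ?f c))) m"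
          unfolding tree_gf_nth sum_distrib_left by (intro sum_mono)
        then show ?thesis unfolding tree_gf_node_weight by (simp add: mult.assoc)
      qed
    qed
    also have "fps_const k * (fps_X * (?B * ?B * ?B)) * leaves_gf = fps_const k * P"
      unfolding P_def by (simp only: mult.assoc)
    also have "fps_nth (fps_const k * P) n = k * fps_nth P n" by simp
    also have "\<dots> \<le> k * (D * ((27 / 4) ^ n * (real n + 1) powr (- 1 / 2)))"
      using P unfolding fps_bounded_def by (intro mult_left_mono) (auto simp: k_def)
    also have "\<dots> \<le> k * (D * (6 * fps_nth leaves_gf n))"
      using leaves_gf_lower[of n] D by (intro mult_left_mono) (auto simp: k_def)
    finally show "(\<Sum>t\<in>step_trees n. loss K t) \<le> 6 * D * real K powr (- 1 / 5) * (\<Sum>t\<in>step_trees n. real (leaves t))"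
      by (simp add: tree_gf_nth mult_ac k_def)
  qed
qed

lemma mean_loss_small:
  assumes "\<epsilon> > 0"
  obtains K where "K \<ge> 1"
    "\<And>n. (\<Sum>t\<in>step_trees n. loss K t) \<le> \<epsilon> * (\<Sum>t\<in>step_trees n. real (leaves t))"
proof -
  obtain C :: real where C: "C > 0"
    "\<And>K n. K > 0 \<Longrightarrow>
      (\<Sum>t\<in>step_trees n. loss K t) \<le> C * real K powr (- 1 / 5) * (\<Sum>t\<in>step_trees n. real (leaves t))"
    using mean_loss_le by blast
  have "((\<lambda>K. C * real K powr (- 1 / 5)) \<longlongrightarrow> C * 0) sequentially"
    by (intro tendsto_intros tendsto_neg_powr filterlim_real_sequentially) auto
  then have "eventually (\<lambda>K. C * real K powr (- 1 / 5) < \<epsilon>) sequentially"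
    using assms by (intro order_tendstoD) auto
  then have "eventually (\<lambda>K. C * real K powr (- 1 / 5) < \<epsilon> \<and> K \<ge> 1) sequentially"
    using eventually_ge_at_top by (rule eventually_conj)
  then obtain K where K: "C * real K powr (- 1 / 5) < \<epsilon>" "K \<ge> 1"
    by (auto dest: eventually_happens)
  show ?thesis
  proof (rule that[OF K(2)])
    fix n
    have "(\<Sum>t\<in>step_trees n. loss K t) \<le> C * real K powr (- 1 / 5) * (\<Sum>t\<in>step_trees n. real (leaves t))"
      using C(2) K(2) by simp
    also have "\<dots> \<le> \<epsilon> * (\<Sum>t\<in>step_trees n. real (leaves t))"
      using K by (intro mult_right_mono sum_nonneg) auto
    finally show "(\<Sum>t\<in>step_trees n. loss K t) \<le> \<epsilon> * (\<Sum>t\<in>step_trees n. real (leaves t))" .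
  qed
qed

text \<open>The additive bound is applied with \<open>h\<close> the number of leaves divided by
  \<open>K\<close>, which is at most 1 on small trees, and \<open>\<theta>\<close> equal to 1/K.
  With \<open>K\<close> such that the mean loss is at most half the leaves, half of the main term
  survives; the factor 3 then gives 1/(6K).\<close>

lemma mean_binary_leaves_linear:
  obtains c :: real where "c > 0" "c \<le> 1"
    "\<And>n. (\<Sum>t\<in>step_trees n. real (binary_leaves t)) \<ge> c * (\<Sum>t\<in>step_trees n. real (leaves t))"
proof -
  obtain K where K: "K \<ge> 1"
    "\<And>n. (\<Sum>t\<in>step_trees n. loss K t) \<le> 1 / 2 * (\<Sum>t\<in>step_trees n. real (leaves t))"
    using mean_loss_small[of "1 / 2"] by auto
  have le: "real (leaves t) / K - loss K t / K \<le> 3 * real (binary_leaves t)" for t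
  proof -
    have "3 * real (binary_leaves t) \<ge> real (leaves t) / K - 1 / K * loss K t"
    proof (rule binary_leaves_ge_additive)
      fix t assume "leaves t \<le> K"
      then have "real (leaves t) / K \<le> 1" by (simp add: divide_le_eq)
      then show "0 \<le> real (leaves t) / K \<and> real (leaves t) / K \<le> binary_leaves t"
        using binary_leaves_pos[of t] by auto
    qed (use K(1) in \<open>auto simp: add_divide_distrib\<close>)
    then show ?thesis by simp
  qed
  show ?thesis
  proof (rule that)
    show "1 / (6 * real K) > 0" "1 / (6 * real K) \<le> 1" using K(1) by auto
    fix n
    have "(\<Sum>t\<in>step_trees n. real (leaves t) / K - loss K t / K) \<le>
        (\<Sum>t\<in>step_trees n. 3 * real (binary_leaves t))"
      by (intro sum_mono le)
    then have "(\<Sum>t\<in>step_trees n. real (leaves t)) / K - (\<Sum>t\<in>step_trees n. loss K t) / K \<le>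
        3 * (\<Sum>t\<in>step_trees n. real (binary_leaves t))"
      by (simp add: sum_subtractf sum_divide_distrib sum_distrib_left)
    moreover have "(\<Sum>t\<in>step_trees n. loss K t) / K \<le>
        (1 / 2 * (\<Sum>t\<in>step_trees n. real (leaves t))) / K"
      using K by (intro divide_right_mono) auto
    ultimately show "1 / (6 * real K) * (\<Sum>t\<in>step_trees n. real (leaves t)) \<le>
        (\<Sum>t\<in>step_trees n. real (binary_leaves t))"
      by (simp add: field_simps)
  qed
qed

section \<open>Concentration of the contribution of small subtrees\<close>

text \<open>The sum of \<open>binary_leaves\<close> over the maximal subtrees with at most \<open>K\<close> leaves.\<close>

fun small_binary_leaves :: "nat \<Rightarrow> ternary_tree \<Rightarrow> nat" where
  "small_binary_leaves K Leaf = 1"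
| "small_binary_leaves K (Node a b c) =
     (if leaves (Node a b c) \<le> K then binary_leaves (Node a b c)
      else small_binary_leaves K a + small_binary_leaves K b + small_binary_leaves K c)"

lemma small_binary_leaves_eq: "leaves t \<le> K \<Longrightarrow> small_binary_leaves K t = binary_leaves t"
  by (cases t) auto

lemma small_binary_leaves_le: "small_binary_leaves K t \<le> leaves t"
proof (induction t)
  case (Node a b c)
  then show ?case using binary_leaves_le[of "Node a b c"] by (simp del: binary_leaves.simps)
qed simp

lemma exp_le_quadratic:
  fixes x :: real
  assumes "\<bar>x\<bar> \<le> 1"
  shows "exp x \<le> 1 + x + x\<^sup>2"
proof (cases "x \<ge> 0")
  case True
  then show ?thesis using assms exp_bound by simp
next
  case False
  define y where "y = - x"
  have y: "y > 0" using False by (simp add: y_def)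
  \<comment> \<open>The product is 1 + y^3.\<close>
  have "1 \<le> (1 - y + y\<^sup>2) * (1 + y)"
    using y by (simp add: algebra_simps power2_eq_square)
  also have "\<dots> \<le> (1 - y + y\<^sup>2) * exp y"
  proof (intro mult_left_mono exp_ge_add_one_self)
    have "1 - y + y\<^sup>2 = (1 - y / 2)\<^sup>2 + 3 / 4 * y\<^sup>2" by (simp add: power2_eq_square algebra_simps)
    then show "0 \<le> 1 - y + y\<^sup>2" by simp
  qed
  finally show ?thesis by (simp add: y_def exp_minus field_simps)
qed

text \<open>
  Above the threshold the summand is multiplicative over the three subtrees, so the bound for all
  sizes follows by induction from the bound for sizes up to \<open>K\<close>, where the positive mean suffices.
\<close>

lemma exponential_moment_small_binary_leaves:
  fixes c :: real
  assumes c: "0 < c" "c \<le> 1" and K: "K \<ge> 1"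
    and mean: "\<And>n. (\<Sum>t\<in>step_trees n. real (binary_leaves t)) \<ge> 2 * c * (\<Sum>t\<in>step_trees n. real (leaves t))"
  shows "(\<Sum>t\<in>step_trees n. exp (- (c / (real K)\<^sup>2) * (small_binary_leaves K t - c * leaves t)))
    \<le> card (step_trees n)"
proof -
  \<comment> \<open>With this rate \<open>r * K\<close> is at most 1, so the quadratic bound on
    \<open>exp\<close> applies, and the quadratic term is at most \<open>r * c\<close>.\<close>
  define r where "r = c / (real K)\<^sup>2"
  define X where "X t = small_binary_leaves K t - c * leaves t" for t
  define w where "w t = exp (- r * X t)" for t
  have r: "r > 0" using c K by (simp add: r_def)
  have "fps_nth (tree_gf w) n \<le> fps_nth tree_count_gf n"
  proof (induction n rule: less_induct)
    case (less n)
    let ?T = "real (card (step_trees n))" and ?L = "\<Sum>t\<in>step_trees n. real (leaves t)"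
    show ?case
    proof (cases "2 * n + 1 \<le> K")
      case True
      have leaves: "leaves t = 2 * n + 1" if "t \<in> step_trees n" for t
        using that by (simp add: step_trees_eq leaves_eq_insertions)
      have w: "w t \<le> 1 - r * X t + r * c" if "t \<in> step_trees n" for t
      proof -
        have "0 \<le> c * leaves t" using c by simp
        then have "X t \<le> leaves t" "- X t \<le> leaves t"
          using small_binary_leaves_le[of K t] c mult_right_mono[of c 1 "real (leaves t)"]
          unfolding X_def by linarith+
        then have X: "\<bar>X t\<bar> \<le> K" using leaves[OF that] True by linarith
        have "r * K \<le> 1"
          using c K by (simp add: r_def power2_eq_square field_simps)
        have "\<bar>- r * X t\<bar> = r * \<bar>X t\<bar>" using r by (simp add: abs_mult)
        also have "\<dots> \<le> r * K" using X r by (intro mult_left_mono) auto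
        also note \<open>r * K \<le> 1\<close>
        finally have "\<bar>- r * X t\<bar> \<le> 1" .
        then have "w t \<le> 1 + (- r * X t) + (- r * X t)\<^sup>2"
          unfolding w_def by (rule exp_le_quadratic)
        also have "(- r * X t)\<^sup>2 = r\<^sup>2 * \<bar>X t\<bar>\<^sup>2" by (simp add: power_mult_distrib)
        also have "\<dots> \<le> r\<^sup>2 * (real K)\<^sup>2" using X by (intro mult_left_mono power_mono) auto
        also have "\<dots> = r * c" using K by (simp add: r_def power2_eq_square)
        finally show ?thesis by simp
      qed
      \<comment> \<open>The mean is at least \<open>2 * c\<close> per leaf and \<open>X\<close>
        subtracts only \<open>c\<close> per leaf. The surplus, at least \<open>c\<close> per tree,
        pays for the quadratic term.\<close>
      have "(\<Sum>t\<in>step_trees n. 1) \<le> ?L"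
        by (intro sum_mono) (simp add: leaves)
      then have "?T \<le> ?L" by simp
      then have "c * ?T \<le> c * ?L" using c by (intro mult_left_mono) auto
      also have "c * ?L \<le> (\<Sum>t\<in>step_trees n. real (binary_leaves t)) - c * ?L"
        using mean[of n] by simp
      also have "\<dots> = (\<Sum>t\<in>step_trees n. X t)"
        using leaves True
        by (simp add: X_def sum_subtractf small_binary_leaves_eq sum_distrib_left[symmetric])
      finally have X: "r * (c * ?T) \<le> r * (\<Sum>t\<in>step_trees n. X t)"
        using r by (intro mult_left_mono) auto
      have "(\<Sum>t\<in>step_trees n. w t) \<le> (\<Sum>t\<in>step_trees n. 1 - r * X t + r * c)"
        by (intro sum_mono w)
      also have "\<dots> = ?T - r * (\<Sum>t\<in>step_trees n. X t) + r * (c * ?T)"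
        by (simp add: sum.distrib sum_subtractf sum_distrib_left algebra_simps)
      finally show ?thesis using X by (simp add: tree_gf_nth)
    next
      case False
      then obtain m where n: "n = Suc m" using K by (cases n) auto
      have split: "w t = node_weight (\<lambda>a b c. w a * w b * w c) t" if "t \<in> step_trees n" for t
      proof (cases t)
        case Leaf
        then show ?thesis using that n by (simp add: step_trees_eq)
      next
        case (Node a b d)
        have "leaves t = 2 * n + 1" using that by (simp add: step_trees_eq leaves_eq_insertions)
        then have "\<not> leaves a + leaves b + leaves d \<le> K" using False Node by simp
        then have "X t = X a + X b + X d" by (simp add: Node X_def distrib_left)
        then show ?thesis using Node by (simp add: w_def algebra_simps flip: exp_add)
      qed
      have le: "fps_nth (tree_gf w) k \<le> fps_nth tree_count_gf k" if "k \<le> m" for k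
        using less that n by simp
      have nonneg: "0 \<le> fps_nth (tree_gf w) k" "0 \<le> fps_nth tree_count_gf k" for k
        by (auto simp: tree_gf_nth w_def intro!: sum_nonneg)
      let ?W = "tree_gf w" and ?A = tree_count_gf
      have nonneg2: "0 \<le> fps_nth (?A * ?A) k" for k
        unfolding fps_mult_nth using nonneg(2) by (intro sum_nonneg mult_nonneg_nonneg)
      have "fps_nth (?W * ?W) k \<le> fps_nth (?A * ?A) k" if "k \<le> m" for k
      proof -
        have "fps_nth (?W * ?W) k \<le> fps_nth (?A * ?W) k"
          by (rule fps_mult_nth_mono) (use le that nonneg in auto)
        also have "\<dots> = fps_nth (?W * ?A) k" by (simp only: mult.commute)
        also have "\<dots> \<le> fps_nth (?A * ?A) k"
          by (rule fps_mult_nth_mono) (use le that nonneg in auto)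
        finally show ?thesis .
      qed
      \<comment> \<open>The factors \<open>?W\<close> are replaced by \<open>?A\<close> one after
        another; only coefficients up to \<open>m\<close> enter, where the induction hypothesis
        holds.\<close>
      then have "fps_nth (?W * ?W * ?W) m \<le> fps_nth (?A * ?A * ?W) m"
        by (intro fps_mult_nth_mono nonneg)
      also have "\<dots> = fps_nth (?W * (?A * ?A)) m" by (simp only: mult.commute)
      also have "\<dots> \<le> fps_nth (?A * (?A * ?A)) m"
        by (intro fps_mult_nth_mono nonneg2 le)
      also have "\<dots> = fps_nth (fps_X * ?A ^ 3) n" by (simp add: n power3_eq_cube mult.assoc)
      also have "\<dots> = fps_nth ?A n"
        using arg_cong[OF tree_count_gf_eq, of "\<lambda>f. fps_nth f n"] n by simp
      finally show ?thesis
        using split by (simp add: n tree_gf_nth[of w "Suc m"] sum_step_trees_Suc)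
    qed
  qed
  then show ?thesis by (simp add: tree_gf_nth w_def X_def r_def)
qed

section \<open>Linear length with high probability\<close>

lemma prob_random_apollonian_network:
  "measure_pmf.prob (random_apollonian_network n) A =
     real (card {t \<in> step_trees n. apollonian_network t \<in> A}) / card (step_trees n)"
  unfolding random_apollonian_network_def
  by (simp add: measure_pmf_of_set step_trees_nonempty finite_step_trees vimage_def Int_def)

text \<open>Markov's inequality for the uniform distribution, in terms of counts.\<close>

lemma card_mult_le_sum:
  fixes f :: "'a \<Rightarrow> real"
  assumes "finite A" "\<And>x. x \<in> A \<Longrightarrow> 0 \<le> f x" "\<And>x. x \<in> A \<Longrightarrow> P x \<Longrightarrow> d \<le> f x"
  shows "real (card {x \<in> A. P x}) * d \<le> sum f A"
proof -
  have "real (card {x \<in> A. P x}) * d = (\<Sum>x\<in>{x \<in> A. P x}. d)" by simp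
  also have "\<dots> \<le> (\<Sum>x\<in>{x \<in> A. P x}. f x)" using assms by (intro sum_mono) auto
  also have "\<dots> \<le> sum f A" using assms by (intro sum_mono2) auto
  finally show ?thesis .
qed

text \<open>The constant is fixed before \<open>\<eta>\<close>; only the threshold \<open>K\<close>
  depends on \<open>\<eta>\<close>. Few \<open>binary_leaves\<close> force either a small
  \<open>small_binary_leaves\<close> or a large loss, and each is shown to have probability at most
  \<open>\<eta> / 2\<close>.\<close>

lemma binary_leaves_linear_whp:
  obtains c :: real where "c > 0"
    "\<And>\<eta> :: real. \<eta> > 0 \<Longrightarrow> \<forall>\<^sub>F n in sequentially.
      real (card {t \<in> step_trees n. real (binary_leaves t) < c * n}) \<le> \<eta> * card (step_trees n)"
proof -
  obtain c0 :: real where c0: "c0 > 0" "c0 \<le> 1"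
    "\<And>n. (\<Sum>t\<in>step_trees n. real (binary_leaves t)) \<ge> c0 * (\<Sum>t\<in>step_trees n. real (leaves t))"
    using mean_binary_leaves_linear by blast
  \<comment> \<open>The exponential moment bound at level \<open>c\<close> asks for a mean of
    \<open>2 * c\<close> per leaf.\<close>
  define c where "c = c0 / 2"
  have c: "c > 0" "c \<le> 1" using c0 by (auto simp: c_def)
  show ?thesis
  proof (rule that)
    show "c / 6 > 0" using c by simp
    fix \<eta> :: real
    assume \<eta>: "\<eta> > 0"
    \<comment> \<open>Markov's inequality at level \<open>c / 4\<close> per leaf turns the mean
      \<open>\<eta> * c / 8\<close> into the probability \<open>\<eta> / 2\<close>.\<close>
    obtain K where K: "K \<ge> 1"
      "\<And>n. (\<Sum>t\<in>step_trees n. loss K t) \<le> \<eta> * c / 8 * (\<Sum>t\<in>step_trees n. real (leaves t))"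
      using mean_loss_small[of "\<eta> * c / 8"] c \<eta> by auto
    define r where "r = c / (real K)\<^sup>2"
    have r: "r > 0" using c K by (simp add: r_def)
    obtain N :: nat where N: "ln (2 / \<eta>) / (r * c) \<le> N"
      using real_arch_simple by blast
    have "r * (c / 2) * (2 * real n + 1) \<ge> ln (2 / \<eta>)" if "n \<ge> N" for n
    proof -
      have "ln (2 / \<eta>) / (r * c) \<le> n + 1 / 2" using N that by simp
      then show ?thesis using r c by (simp add: field_simps)
    qed
    then have "\<forall>\<^sub>F n in sequentially. r * (c / 2) * (2 * real n + 1) \<ge> ln (2 / \<eta>)"
      by (rule eventually_sequentiallyI)
    then show "\<forall>\<^sub>F n in sequentially.
      real (card {t \<in> step_trees n. real (binary_leaves t) < c / 6 * n}) \<le> \<eta> * card (step_trees n)"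
    proof eventually_elim
      case (elim n)
      let ?T = "real (card (step_trees n))"
      let ?S1 = "{t \<in> step_trees n. small_binary_leaves K t < c / 2 * leaves t}"
      let ?S2 = "{t \<in> step_trees n. loss K t \<ge> c / 4 * leaves t}"
      have leaves: "leaves t = 2 * n + 1" if "t \<in> step_trees n" for t
        using that by (simp add: step_trees_eq leaves_eq_insertions)
      have "?S1 \<union> ?S2 \<supseteq> {t \<in> step_trees n. real (binary_leaves t) < c / 6 * n}"
      proof (rule subsetI, rule ccontr)
        fix t
        assume t: "t \<in> {t \<in> step_trees n. real (binary_leaves t) < c / 6 * n}" "t \<notin> ?S1 \<union> ?S2"
        \<comment> \<open>Here \<open>h\<close> is \<open>small_binary_leaves K\<close> and
          \<open>\<theta>\<close> is 1. Outside both sets the right side is at least c/2 - c/4 = c/4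
          per leaf, and with 2n + 1 leaves this gives \<open>binary_leaves\<close> at least c n /
          6.\<close>
        have "3 * real (binary_leaves t) \<ge> real (small_binary_leaves K t) - 1 * loss K t"
          by (rule binary_leaves_ge_additive)
            (use K(1) small_binary_leaves_le small_binary_leaves_eq in auto)
        also have "real (small_binary_leaves K t) - 1 * loss K t \<ge> c / 4 * leaves t"
          using t by auto
        finally show False using t leaves[of t] c by (simp add: field_simps)
      qed
      then have "real (card {t \<in> step_trees n. real (binary_leaves t) < c / 6 * n}) \<le> card (?S1 \<union> ?S2)"
        by (intro of_nat_mono card_mono) (auto simp: finite_step_trees)
      also have "\<dots> \<le> real (card ?S1) + real (card ?S2)"
        using card_Un_le[of ?S1 ?S2] by linarith
      also have "real (card ?S1) \<le> \<eta> / 2 * ?T"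
      proof -
        \<comment> \<open>This is a Chernoff bound: on \<open>?S1\<close> the centred sum is at most
          -c/2 per leaf. For large \<open>n\<close> the exponential exceeds
          \<open>2 / \<eta>\<close>.\<close>
        have "real (card ?S1) * exp (r * (c / 2) * (2 * real n + 1)) \<le>
            (\<Sum>t\<in>step_trees n. exp (- r * (small_binary_leaves K t - c * leaves t)))"
        proof (intro card_mult_le_sum finite_step_trees)
          fix t assume t: "t \<in> step_trees n" "small_binary_leaves K t < c / 2 * leaves t"
          have "c / 2 * (2 * real n + 1) \<le> - (small_binary_leaves K t - c * leaves t)"
            using t(2) leaves[OF t(1)] by (simp add: algebra_simps)
          from mult_left_mono[OF this, of r]
          show "exp (r * (c / 2) * (2 * real n + 1)) \<le> exp (- r * (small_binary_leaves K t - c * leaves t))"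
            using r by (simp add: algebra_simps)
        qed auto
        also have "\<dots> \<le> ?T"
          unfolding r_def using c0 c K by (intro exponential_moment_small_binary_leaves) (auto simp: c_def)
        finally have 1: "real (card ?S1) * exp (r * (c / 2) * (2 * real n + 1)) \<le> ?T" .
        have "2 / \<eta> = exp (ln (2 / \<eta>))" using \<eta> by simp
        also have "\<dots> \<le> exp (r * (c / 2) * (2 * real n + 1))" using elim by simp
        finally have "real (card ?S1) * (2 / \<eta>) \<le> real (card ?S1) * exp (r * (c / 2) * (2 * real n + 1))"
          by (intro mult_left_mono) auto
        with 1 have "real (card ?S1) * (2 / \<eta>) \<le> ?T" by linarith
        then show ?thesis using \<eta> by (simp add: field_simps)
      qed
      also have "real (card ?S2) \<le> \<eta> / 2 * ?T"
      proof -
        have "real (card ?S2) * (c / 4 * (2 * real n + 1)) \<le> (\<Sum>t\<in>step_trees n. loss K t)"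
          by (intro card_mult_le_sum finite_step_trees loss_nonneg) (auto simp: leaves add.commute)
        also have "\<dots> \<le> \<eta> * c / 8 * (\<Sum>t\<in>step_trees n. real (leaves t))" by (rule K)
        also have "\<dots> = \<eta> / 2 * ?T * (c / 4 * (2 * real n + 1))"
          using leaves by simp
        finally show ?thesis
          using c by (subst (asm) mult_le_cancel_right) auto
      qed
      finally show ?case by simp
    qed
  qed
qed

theorem mainTheorem2:
  shows "\<exists>c::real. c > 0 \<and>
    (\<lambda>n. measure_pmf.prob (random_apollonian_network n)
           {G. real (longest_path_length G) \<ge> c * real n}) \<longlonglongrightarrow> 1"
proof -
  obtain c :: real where c: "c > 0"
    "\<And>\<eta> :: real. \<eta> > 0 \<Longrightarrow> \<forall>\<^sub>F n in sequentially.
      real (card {t \<in> step_trees n. real (binary_leaves t) < c * n}) \<le> \<eta> * card (step_trees n)"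
    using binary_leaves_linear_whp by blast
  let ?p = "\<lambda>n. measure_pmf.prob (random_apollonian_network n)
           {G. real (longest_path_length G) \<ge> c * real n}"
  have "?p \<longlonglongrightarrow> 1"
  proof (rule order_tendstoI)
    fix a :: real
    assume "1 < a"
    then show "\<forall>\<^sub>F n in sequentially. ?p n < a"
      by (intro always_eventually allI) (rule le_less_trans[OF measure_pmf.prob_le_1])
  next
    fix a :: real
    assume "a < 1"
    define \<eta> where "\<eta> = (1 - a) / 2"
    have \<eta>: "\<eta> > 0" "a < 1 - \<eta>" using \<open>a < 1\<close> by (auto simp: \<eta>_def field_simps)
    show "\<forall>\<^sub>F n in sequentially. a < ?p n"
      using c(2)[OF \<eta>(1)]
    proof eventually_elim
      case (elim n)
      let ?S = "{t \<in> step_trees n. real (binary_leaves t) < c * n}"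
      let ?T = "real (card (step_trees n))"
      let ?G = "{t \<in> step_trees n. apollonian_network t \<in> {G. real (longest_path_length G) \<ge> c * real n}}"
      have T: "?T > 0" using tree_count_gf_nth_pos[of n] by (simp add: tree_count_gf_nth)
      \<comment> \<open>Every tree outside \<open>?S\<close> has a path of at least
        \<open>binary_leaves t\<close> edges, so the same \<open>c\<close> serves for the
        network.\<close>
      have "step_trees n - ?S \<subseteq> ?G"
        using longest_path_length_ge by (auto simp: not_less intro: order_trans)
      then have "card (step_trees n - ?S) \<le> card ?G"
        by (intro card_mono) (auto simp: finite_step_trees)
      moreover have "card (step_trees n - ?S) = card (step_trees n) - card ?S"
        by (intro card_Diff_subset) (auto simp: finite_step_trees)
      moreover have "card ?S \<le> card (step_trees n)"
        by (intro card_mono) (auto simp: finite_step_trees)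
      ultimately have "?T - real (card ?S) \<le> real (card ?G)" by linarith
      then have "(1 - \<eta>) * ?T \<le> real (card ?G)" using elim by (simp add: algebra_simps)
      then have "1 - \<eta> \<le> ?p n"
        unfolding prob_random_apollonian_network using T by (simp add: pos_le_divide_eq)
      then show ?case using \<eta>(2) by simp
    qed
  qed
  then show ?thesis using c(1) by blast
qed

end
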